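(* Let $\nu_0>0$ be constant and $k=2m$, $m\in\mathbb N$. Consider the system of ordinary differential equations $$\dot V=-E-\nu_0|V|^kV,\quad \dot E=V,\quad \dot q=-s-q^2-\nu_0(k+1)|V|^k q,\quad \dot s=q-qs,$$ describing, along the characteristic starting from $x_0\in\mathbb R$, the solution and its derivatives, with initial data $(E,V)|_{t=0}=(E_0,0)$ (so that $V(0)=0$, $q(0)=0$, $E(0)=E_0(x_0)$, $s(0)=s_0(x_0)$). Set $\epsilon=E_0(x_0)$ and $\delta=s_0(x_0)-\frac12$. Then, in a small neighbourhood of the point $(s_0,E_0)=(\frac12,0)$, the threshold curve in the plane of the initial data $(s_0(x_0),E_0(x_0))$ has the structure $$\delta=\nu_0\,C_k\,\epsilon^k+o(\epsilon^k),\qquad \epsilon\to0,$$ where $C_k>0$ is a constant.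
   Context: The ODE system arises from the one-dimensional Euler-Poisson system $V_t+VV_x=-E-\nu(|V|)V$, $E_t+VE_x-V=0$ with $\nu(|V|)=\nu_0|V|^k$, where $q=V_x$, $s=E_x$ along characteristics $\dot x=V$, and $s_0(x_0)=E_x(x_0,0)$; the initial velocity is identically zero. It is assumed that $s_0<1$. The threshold curve is the curve in the plane $(s_0,E_0)$ that separates the initial data (with $V(0)=q(0)=0$) for which the solution of the ODE system exists for all $t\ge0$ (globally smooth solution) from those for which the derivatives $q,s$ become infinite in finite time. *)

theory Defs
  imports "HOL-Analysis.Analysis" "HOL-Library.Landau_Symbols"
begin

definition ep_solution_on ::
  "real set \<Rightarrow> real \<Rightarrow> nat \<Rightarrow> real \<Rightarrow> real \<Rightarrow>
    (real \<Rightarrow> real) \<Rightarrow> (real \<Rightarrow> real) \<Rightarrow> (real \<Rightarrow> real) \<Rightarrow> (real \<Rightarrow> real) \<Rightarrow> bool"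
where
  "ep_solution_on J \<nu>\<^sub>0 k s\<^sub>0 E\<^sub>0 V E q s \<longleftrightarrow>
     V 0 = 0 \<and> E 0 = E\<^sub>0 \<and> q 0 = 0 \<and> s 0 = s\<^sub>0 \<and>
     (\<forall>t\<in>J.
        (V has_real_derivative (- E t - \<nu>\<^sub>0 * \<bar>V t\<bar> ^ k * V t)) (at t within J) \<and>
        (E has_real_derivative V t) (at t within J) \<and>
        (q has_real_derivative
           (- s t - (q t)\<^sup>2 - \<nu>\<^sub>0 * (real k + 1) * \<bar>V t\<bar> ^ k * q t)) (at t within J) \<and>
        (s has_real_derivative (q t - q t * s t)) (at t within J))"

definition globally_smooth :: "real \<Rightarrow> nat \<Rightarrow> real \<Rightarrow> real \<Rightarrow> bool" where
  "globally_smooth \<nu>\<^sub>0 k s\<^sub>0 E\<^sub>0 \<longleftrightarrow>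
     (\<exists>V E q s. ep_solution_on {0..} \<nu>\<^sub>0 k s\<^sub>0 E\<^sub>0 V E q s)"

definition blows_up :: "real \<Rightarrow> nat \<Rightarrow> real \<Rightarrow> real \<Rightarrow> bool" where
  "blows_up \<nu>\<^sub>0 k s\<^sub>0 E\<^sub>0 \<longleftrightarrow>
     (\<exists>T>0. \<exists>V E q s. ep_solution_on {0..<T} \<nu>\<^sub>0 k s\<^sub>0 E\<^sub>0 V E q s \<and>
        filterlim q at_infinity (at_left T) \<and> filterlim s at_infinity (at_left T))"

text \<open>
  The plane of initial data consists of the pairs \<open>(s\<^sub>0, E\<^sub>0)\<close> with \<open>s\<^sub>0 < 1\<close>; its threshold curve
  is the common boundary of the smooth data and the data that blow up.
\<close>

definition threshold_curve :: "real \<Rightarrow> nat \<Rightarrow> (real \<times> real) set" where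
  "threshold_curve \<nu>\<^sub>0 k =
     {(s\<^sub>0, E\<^sub>0). s\<^sub>0 < 1} \<inter>
     closure {(s\<^sub>0, E\<^sub>0). s\<^sub>0 < 1 \<and> globally_smooth \<nu>\<^sub>0 k s\<^sub>0 E\<^sub>0} \<inter>
     closure {(s\<^sub>0, E\<^sub>0). s\<^sub>0 < 1 \<and> blows_up \<nu>\<^sub>0 k s\<^sub>0 E\<^sub>0}"

end

theory Submission
  imports Defs
begin

text \<open>
  The blow-up of the nonlinear pair \<open>(q, s)\<close> is a linear phenomenon. Put \<open>y = 1 / (1 - s)\<close>; then
  \<open>y' = q y\<close>, and \<open>y - 1\<close> solves \<open>z'' + \<nu> (k + 1) \<bar>V\<bar>\<^sup>k z' + z = 0\<close>, which is the linearisation of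
  the equation \<open>E'' + \<nu> \<bar>E'\<bar>\<^sup>k E' + E = 0\<close> of the pair \<open>(E, V)\<close>. Hence \<open>y = 1 + \<lambda> w\<close> with
  \<open>\<lambda> = s\<^sub>0 / (1 - s\<^sub>0)\<close> and \<open>w\<close> the solution with \<open>w 0 = 1\<close>, \<open>w' 0 = 0\<close>. The derivatives stay finite
  exactly as long as \<open>y > 0\<close>, so everything depends on the depth \<open>M = sup (- w)\<close>: the data are smooth
  if \<open>\<lambda> M < 1\<close> and blow up if \<open>\<lambda> M > 1\<close>
  (\<open>globally_smooth_if_shallow\<close>, \<open>blows_up_if_deep\<close>), and
  the threshold is \<open>s\<^sub>0 = 1 / (1 + M)\<close>.

  Writing \<open>V = \<epsilon> v\<close>, \<open>E = \<epsilon> e\<close> turns the friction coefficient into \<open>\<kappa> = \<nu> \<bar>\<epsilon>\<bar>\<^sup>k\<close>, and \<open>w\<close> and \<open>M\<close>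
  depend on \<open>k\<close> and \<open>\<kappa>\<close> only. For \<open>\<kappa> = 0\<close> the solution is \<open>w = cos\<close>, so \<open>M = 1\<close> and the threshold is
  \<open>1/2\<close>. To first order in \<open>K = \<kappa> (k + 1)\<close>, with \<open>v\<close> and \<open>w'\<close> both close to \<open>- sin\<close>, the damping raises
  the first minimum of \<open>w\<close>, near \<open>t = \<pi>\<close>, by \<open>K\<close> times the integral of \<open>sin\<^sup>k\<^sup>+\<^sup>2\<close> over \<open>[0, \<pi>]\<close>
  (\<open>w_pi_expansion\<close>). The minimum is attained slightly off \<open>\<pi>\<close>, but that costs only
  \<open>O(K\<^sup>2)\<close>, because \<open>cos\<close> is quadratic at its minimum (\<open>trough_expansion\<close>). So
  \<open>\<delta> = 1 / (1 + M) - 1/2 = (1 - M) / 4 + O(K\<^sup>2)\<close>, which gives the constant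
  \<open>C = (k + 1) / 4\<close> times that integral, and a remainder \<open>O(\<epsilon>\<^sup>2\<^sup>k)\<close>.

  The threshold curve is defined through closures, so its identification with the graph of \<open>\<delta>\<close>
  also requires that \<open>M\<close> be continuous in \<open>\<kappa>\<close> (\<open>depth_continuous\<close>) and that no datum be both
  smooth and blowing up (\<open>not_globally_smooth_and_blows_up\<close>). Existence of \<open>(e, v, w, w')\<close> for all
  times comes from a Picard iteration; uniqueness and continuous dependence come
  from one energy inequality (\<open>oscillator_energy\<close>), whose sign is right because \<open>x \<mapsto> \<bar>x\<bar>\<^sup>k x\<close> is monotone.
\<close>

section \<open>Global solutions of Lipschitz differential equations\<close>

lemma integral_has_vector_derivative_atLeast:
  fixes g :: "real \<Rightarrow> 'a::banach"
  assumes "continuous_on {0..} g" "0 \<le> t"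
  shows "((\<lambda>x. integral {0..x} g) has_vector_derivative g t) (at t within {0..})"
proof -
  have "((\<lambda>x. integral {0..x} g) has_vector_derivative g t) (at t within {0..t + 1})"
    using assms by (intro integral_has_vector_derivative continuous_on_subset[OF assms(1)]) auto
  moreover have "at t within {0..t + 1} = at t within {0..}"
    by (rule at_within_nhd[of _ "{..<t + 1}"]) auto
  ultimately show ?thesis by simp
qed

text \<open>
  In the norm weighted by \<open>exp (- K t)\<close> integration is small, of size \<open>1 / K\<close>, uniformly on the half-line.
\<close>

lemma weighted_integral_bound:
  fixes g :: "real \<Rightarrow> 'a::banach"
  assumes g: "continuous_on {0..} g" and K: "K > 0" and t: "0 \<le> t" and "0 \<le> A"
    and bd: "\<And>s. 0 \<le> s \<Longrightarrow> norm (g s) \<le> A * exp (K * s)"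
  shows "exp (- (K * t)) * norm (integral {0..t} g) \<le> A / K"
proof -
  have hi: "((\<lambda>s. A * exp (K * s)) has_integral (A * exp (K * t) / K - A * exp (K * 0) / K)) {0..t}"
    using K t by (intro fundamental_theorem_of_calculus)
      (auto intro!: derivative_eq_intros simp: has_real_derivative_iff_has_vector_derivative[symmetric])
  have "norm (integral {0..t} g) \<le> integral {0..t} (\<lambda>s. A * exp (K * s))"
    by (rule integral_norm_bound_integral)
      (auto intro!: bd integrable_continuous_real continuous_on_subset[OF g] continuous_intros)
  also have "\<dots> = A * exp (K * t) / K - A / K"
    using integral_unique[OF hi] by simp
  also have "\<dots> \<le> A * exp (K * t) / K" using assms by simp
  finally have "exp (- (K * t)) * norm (integral {0..t} g) \<le> exp (- (K * t)) * (A * exp (K * t) / K)"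
    by (intro mult_left_mono) auto
  also have "\<dots> = A / K" by (simp add: exp_minus field_simps)
  finally show ?thesis .
qed

text \<open>
  A globally Lipschitz field has solutions on the whole half-line. The substitution
  \<open>x t = exp (K t) u t\<close> makes the Picard operator a contraction on bounded continuous functions \<open>u\<close> as soon
  as \<open>K > L\<close>, so a single fixed point serves all times and no continuation argument arises.
\<close>

theorem global_picard:
  fixes F :: "real \<Rightarrow> 'a::banach \<Rightarrow> 'a"
  assumes cont: "\<And>x. continuous_on {0..} x \<Longrightarrow> continuous_on {0..} (\<lambda>t. F t (x t))"
    and lip: "\<And>t x y. 0 \<le> t \<Longrightarrow> norm (F t x - F t y) \<le> L * norm (x - y)"
    and bdd: "\<And>t. 0 \<le> t \<Longrightarrow> norm (F t 0) \<le> B"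
  shows "\<exists>x. x 0 = x0 \<and> (\<forall>t\<ge>0. (x has_vector_derivative F t (x t)) (at t within {0..}))"
proof -
  define K where "K = 2 * (\<bar>L\<bar> + 1)"
  have K: "K > 0" by (simp add: K_def)
  define G where "G u s = F s (exp (K * s) *\<^sub>R apply_bcontfun u s)" for u :: "real \<Rightarrow>\<^sub>C 'a" and s
  \<comment> \<open>The absolute value extends the operator evenly to the whole line, the domain of
    the type of bounded continuous functions.\<close>
  define \<Phi> where "\<Phi> u t = exp (- (K * \<bar>t\<bar>)) *\<^sub>R (x0 + integral {0..\<bar>t\<bar>} (G u))" for u t
  have lip': "norm (F t x - F t y) \<le> \<bar>L\<bar> * norm (x - y)" if "0 \<le> t" for t x y
    using lip[OF that, of x y] by (smt (verit) mult_right_mono norm_ge_zero)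
  have G: "continuous_on {0..} (G u)" for u
    unfolding G_def by (intro cont continuous_intros continuous_on_apply_bcontfun)
  have dI: "((\<lambda>x. integral {0..x} (G u)) has_vector_derivative G u t) (at t within {0..})"
    if "0 \<le> t" for u t
    using integral_has_vector_derivative_atLeast[OF G that] .
  have cI: "continuous_on {0..} (\<lambda>x. integral {0..x} (G u))" for u
    by (rule continuous_on_vector_derivative) (use dI in auto)
  have c\<Phi>: "continuous_on UNIV (\<Phi> u)" for u
  proof -
    have "continuous_on UNIV (\<lambda>t. integral {0..\<bar>t\<bar>} (G u))"
      by (rule continuous_on_compose2[OF cI]) (auto intro!: continuous_intros)
    then show ?thesis unfolding \<Phi>_def by (intro continuous_intros)
  qed
  have b\<Phi>: "bounded (range (\<Phi> u))" for u
  proof -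
    obtain A where A: "\<And>t. norm (apply_bcontfun u t) \<le> A"
      using bounded_apply_bcontfun[of u] unfolding bounded_iff by auto
    have A0: "A \<ge> 0" using A[of 0] norm_ge_zero order_trans by blast
    have B0: "B \<ge> 0" using bdd[of 0] norm_ge_zero order_trans by (metis order_refl)
    have "norm (G u s) \<le> (B + \<bar>L\<bar> * A) * exp (K * s)" if s: "0 \<le> s" for s
    proof -
      have "norm (G u s) \<le> norm (F s 0) + norm (G u s - F s 0)"
        by (metis add.commute diff_add_cancel norm_triangle_ineq)
      also have "norm (G u s - F s 0) \<le> \<bar>L\<bar> * (exp (K * s) * norm (u s))"
        using lip'[OF s, of _ 0] unfolding G_def by (metis abs_exp_cancel diff_zero norm_scaleR)
      also have "\<dots> \<le> \<bar>L\<bar> * (exp (K * s) * A)"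
        using A by (intro mult_left_mono) auto
      also have "norm (F s 0) \<le> B * exp (K * s)"
        using bdd[OF s] B0 K s by (smt (verit) mult_le_cancel_left1 one_le_exp_iff mult_nonneg_nonneg)
      finally show ?thesis by (simp add: algebra_simps)
    qed
    from weighted_integral_bound[OF G K _ _ this]
    have *: "exp (- (K * \<bar>t\<bar>)) * norm (integral {0..\<bar>t\<bar>} (G u)) \<le> (B + \<bar>L\<bar> * A) / K" for t
      using A0 B0 by simp
    have "norm (\<Phi> u t) \<le> norm x0 + (B + \<bar>L\<bar> * A) / K" for t
    proof -
      have "norm (\<Phi> u t) \<le> exp (- (K * \<bar>t\<bar>)) * (norm x0 + norm (integral {0..\<bar>t\<bar>} (G u)))"
        unfolding \<Phi>_def by (simp add: norm_triangle_ineq)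
      also have "\<dots> \<le> norm x0 + (B + \<bar>L\<bar> * A) / K"
      proof -
        have "exp (- (K * \<bar>t\<bar>)) * norm x0 \<le> 1 * norm x0"
          using K by (intro mult_right_mono) auto
        with *[of t] show ?thesis by (simp add: distrib_left)
      qed
      finally show ?thesis .
    qed
    then show ?thesis unfolding bounded_iff by blast
  qed
  define \<Psi> where "\<Psi> u = Bcontfun (\<Phi> u)" for u
  have \<Psi>: "apply_bcontfun (\<Psi> u) = \<Phi> u" for u
    unfolding \<Psi>_def using c\<Phi> b\<Phi> by (intro Bcontfun_inverse) (simp add: bcontfun_def)
  have contr: "dist (\<Psi> u) (\<Psi> w) \<le> 1/2 * dist u w" for u w
  proof (rule dist_bound)
    fix t
    have int: "G u integrable_on {0..\<bar>t\<bar>}" for u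
      by (intro integrable_continuous_real continuous_on_subset[OF G]) auto
    have "dist (\<Psi> u t) (\<Psi> w t) =
        norm (exp (- (K * \<bar>t\<bar>)) *\<^sub>R (integral {0..\<bar>t\<bar>} (G u) - integral {0..\<bar>t\<bar>} (G w)))"
      unfolding \<Psi> \<Phi>_def dist_norm by (simp add: algebra_simps)
    also have "\<dots> = exp (- (K * \<bar>t\<bar>)) * norm (integral {0..\<bar>t\<bar>} (\<lambda>s. G u s - G w s))"
      using int by (simp add: integral_diff)
    also have "\<dots> \<le> (\<bar>L\<bar> * dist u w) / K"
    proof (rule weighted_integral_bound)
      show "continuous_on {0..} (\<lambda>s. G u s - G w s)" by (intro continuous_intros G)
      fix s :: real assume s: "0 \<le> s"
      have "norm (G u s - G w s) \<le> \<bar>L\<bar> * norm (exp (K * s) *\<^sub>R u s - exp (K * s) *\<^sub>R w s)"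
        unfolding G_def by (rule lip'[OF s])
      also have "\<dots> = \<bar>L\<bar> * (exp (K * s) * dist (u s) (w s))"
        by (simp add: dist_norm flip: scaleR_diff_right)
      also have "\<dots> \<le> \<bar>L\<bar> * (exp (K * s) * dist u w)"
        by (intro mult_left_mono dist_bounded) auto
      finally show "norm (G u s - G w s) \<le> \<bar>L\<bar> * dist u w * exp (K * s)" by (simp add: ac_simps)
    qed (use K in auto)
    also have "\<dots> \<le> 1/2 * dist u w"
      unfolding K_def by (simp add: field_simps)
    finally show "dist (\<Psi> u t) (\<Psi> w t) \<le> 1/2 * dist u w" .
  qed
  obtain u where u: "\<Psi> u = u"
    using banach_fix_type[of "1/2" \<Psi>] contr by auto
  define x where "x t = x0 + integral {0..t} (G u)" for t
  have xu: "exp (K * t) *\<^sub>R u t = x t" if "0 \<le> t" for t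
  proof -
    have "u t = exp (- (K * t)) *\<^sub>R x t"
      using fun_cong[OF \<Psi>[of u], of t] that unfolding u \<Phi>_def x_def by simp
    then show ?thesis by (simp add: exp_minus)
  qed
  have "(x has_vector_derivative F t (x t)) (at t within {0..})" if "0 \<le> t" for t
  proof -
    have "(x has_vector_derivative 0 + G u t) (at t within {0..})"
      unfolding x_def using dI[OF that] by (intro has_vector_derivative_add) auto
    then show ?thesis using xu[OF that] by (simp add: G_def)
  qed
  moreover have "x 0 = x0" by (simp add: x_def)
  ultimately show ?thesis by blast
qed

section \<open>Forced harmonic oscillators\<close>

lemma nonincreasing_if_deriv_nonpos:
  fixes h :: "real \<Rightarrow> real"
  assumes ab: "a \<le> b"
    and d: "\<And>t. t \<in> {a..b} \<Longrightarrow> (h has_real_derivative h' t) (at t within {a..b})"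
    and np: "\<And>t. t \<in> {a..b} \<Longrightarrow> h' t \<le> 0"
  shows "h b \<le> h a"
proof (rule DERIV_nonpos_imp_decreasing_open[OF ab])
  show "continuous_on {a..b} h"
    by (rule DERIV_continuous_on[OF d])
  fix x assume "a < x" "x < b"
  then have "(h has_real_derivative h' x) (at x)"
    using d[of x] by (simp add: at_within_Icc_at)
  then show "\<exists>y. (h has_real_derivative y) (at x) \<and> y \<le> 0"
    using np[of x] \<open>a < x\<close> \<open>x < b\<close> by auto
qed

lemma deriv_bound_imp_diff_bound:
  fixes h :: "real \<Rightarrow> real"
  assumes ab: "a \<le> b"
    and d: "\<And>t. t \<in> {a..b} \<Longrightarrow> (h has_real_derivative h' t) (at t within {a..b})"
    and bd: "\<And>t. t \<in> {a..b} \<Longrightarrow> \<bar>h' t\<bar> \<le> \<rho>"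
  shows "\<bar>h b - h a\<bar> \<le> \<rho> * (b - a)"
proof -
  have "h b - \<rho> * b \<le> h a - \<rho> * a"
    by (rule nonincreasing_if_deriv_nonpos[OF ab, where h' = "\<lambda>t. h' t - \<rho>"])
       (use bd in \<open>auto intro!: derivative_eq_intros d simp: abs_le_iff\<close>)
  moreover have "- h b - \<rho> * b \<le> - h a - \<rho> * a"
    by (rule nonincreasing_if_deriv_nonpos[OF ab, where h' = "\<lambda>t. - h' t - \<rho>"])
       (use bd in \<open>auto intro!: derivative_eq_intros d simp: abs_le_iff\<close>)
  ultimately show ?thesis by (simp add: abs_le_iff algebra_simps)
qed

text \<open>
  Both the pair \<open>(E, V)\<close> and the linearised pair have this form, with the friction as the
  force \<open>f\<close>; keeping \<open>f\<close> as an arbitrary function of time lets differences of two solutions with different frictions have this form again.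
\<close>

definition oscillator_on :: "real set \<Rightarrow> (real \<Rightarrow> real) \<Rightarrow> (real \<Rightarrow> real) \<Rightarrow> (real \<Rightarrow> real) \<Rightarrow> bool" where
  "oscillator_on J f x y \<longleftrightarrow> (\<forall>t\<in>J.
     (x has_real_derivative y t) (at t within J) \<and>
     (y has_real_derivative - x t - f t) (at t within J))"

lemma oscillator_on_subset: "oscillator_on J f x y \<Longrightarrow> I \<subseteq> J \<Longrightarrow> oscillator_on I f x y"
  unfolding oscillator_on_def by (meson DERIV_subset subsetD)

lemma oscillator_on_continuous:
  assumes "oscillator_on J f x y"
  shows "continuous_on J x" "continuous_on J y"
proof -
  show "continuous_on J x"
    by (rule DERIV_continuous_on[where D = y]) (use assms in \<open>auto simp: oscillator_on_def\<close>)
  show "continuous_on J y"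
    by (rule DERIV_continuous_on[where D = "\<lambda>t. - x t - f t"])
      (use assms in \<open>auto simp: oscillator_on_def\<close>)
qed

lemma oscillator_on_diff:
  "oscillator_on J f x y \<Longrightarrow> oscillator_on J g u v \<Longrightarrow>
    oscillator_on J (\<lambda>t. f t - g t) (\<lambda>t. x t - u t) (\<lambda>t. y t - v t)"
  unfolding oscillator_on_def by (auto intro!: derivative_eq_intros)

lemma oscillator_on_scale:
  "oscillator_on J f x y \<Longrightarrow> oscillator_on J (\<lambda>t. a * f t) (\<lambda>t. a * x t) (\<lambda>t. a * y t)"
  unfolding oscillator_on_def by (auto intro!: derivative_eq_intros simp: algebra_simps)

lemma oscillator_on_cong:
  "oscillator_on J f x y \<Longrightarrow> (\<And>t. t \<in> J \<Longrightarrow> f t = g t) \<Longrightarrow> oscillator_on J g x y"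
  unfolding oscillator_on_def by auto

lemma oscillator_cos: "oscillator_on J (\<lambda>_. 0) cos (\<lambda>t. - sin t)"
  unfolding oscillator_on_def by (auto intro!: derivative_eq_intros)

text \<open>
  The energy \<open>x\<^sup>2 + y\<^sup>2\<close> has derivative \<open>- 2 f y\<close>. With \<open>\<rho> = 0\<close> this yields decay and, applied to
  differences, uniqueness; with \<open>\<rho> > 0\<close> it yields continuous dependence.
\<close>

lemma oscillator_energy:
  assumes o: "oscillator_on J f x y" and sub: "{a..b} \<subseteq> J" and ab: "a \<le> b"
    and f: "\<And>t. t \<in> {a..b} \<Longrightarrow> - \<rho> \<le> f t * y t"
  shows "(x b)\<^sup>2 + (y b)\<^sup>2 \<le> (x a)\<^sup>2 + (y a)\<^sup>2 + 2 * \<rho> * (b - a)"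
proof -
  have o': "oscillator_on {a..b} f x y" using oscillator_on_subset[OF o sub] .
  have "(x b)\<^sup>2 + (y b)\<^sup>2 - 2 * \<rho> * b \<le> (x a)\<^sup>2 + (y a)\<^sup>2 - 2 * \<rho> * a"
  proof (rule nonincreasing_if_deriv_nonpos[OF ab, where h' = "\<lambda>t. - 2 * (f t * y t) - 2 * \<rho>"])
    fix t assume t: "t \<in> {a..b}"
    then have d: "(x has_real_derivative y t) (at t within {a..b})"
      "(y has_real_derivative - x t - f t) (at t within {a..b})"
      using o' unfolding oscillator_on_def by auto
    show "((\<lambda>t. (x t)\<^sup>2 + (y t)\<^sup>2 - 2 * \<rho> * t) has_real_derivative - 2 * (f t * y t) - 2 * \<rho>)
        (at t within {a..b})"
      by (rule derivative_eq_intros d refl)+ (simp add: algebra_simps)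
    show "- 2 * (f t * y t) - 2 * \<rho> \<le> 0" using f[OF t] by simp
  qed
  then show ?thesis by (simp add: algebra_simps)
qed

text \<open>
  A force of size \<open>\<rho>\<close> moves the solution away from \<open>cos\<close> by an amount linear in \<open>\<rho>\<close>. The energy
  inequality would only give the order \<open>sqrt \<rho>\<close>, too weak for an expansion with quadratic error. In the
  coordinates rotating with the free oscillator the derivative is the force alone.
\<close>

lemma oscillator_perturbation:
  assumes o: "oscillator_on J f x y" and sub: "{0..t} \<subseteq> J" and t: "0 \<le> t"
    and x0: "x 0 = 1" and y0: "y 0 = 0" and f: "\<And>s. s \<in> {0..t} \<Longrightarrow> \<bar>f s\<bar> \<le> \<rho>"
  shows "\<bar>x t - cos t\<bar> \<le> 2 * (\<rho> * t)" "\<bar>y t + sin t\<bar> \<le> 2 * (\<rho> * t)"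
proof -
  define X Y where "X s = x s - cos s" and "Y s = y s + sin s" for s
  have "oscillator_on {0..t} f X Y"
    using oscillator_on_diff[OF oscillator_on_subset[OF o sub] oscillator_cos]
    by (simp add: X_def[abs_def] Y_def[abs_def])
  then have d: "(X has_real_derivative Y s) (at s within {0..t})"
      "(Y has_real_derivative - X s - f s) (at s within {0..t})" if "s \<in> {0..t}" for s
    using that unfolding oscillator_on_def by auto
  have le: "\<bar>f s * c\<bar> \<le> \<rho>" if "s \<in> {0..t}" "\<bar>c\<bar> \<le> 1" for s c
    using f[OF that(1)] that(2) mult_mono[of "\<bar>f s\<bar>" \<rho> "\<bar>c\<bar>" 1] by (simp add: abs_mult)
  \<comment> \<open>\<open>A\<close> and \<open>B\<close> are the deviation at time \<open>t\<close> in rotating coordinates.\<close>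
  define A B where "A = X t * cos t - Y t * sin t" and "B = X t * sin t + Y t * cos t"
  have A: "\<bar>A\<bar> \<le> \<rho> * t"
  proof -
    have "\<bar>(X t * cos t - Y t * sin t) - (X 0 * cos 0 - Y 0 * sin 0)\<bar> \<le> \<rho> * (t - 0)"
    proof (rule deriv_bound_imp_diff_bound[OF t, where h' = "\<lambda>s. f s * sin s"])
      fix s assume s: "s \<in> {0..t}"
      show "((\<lambda>s. X s * cos s - Y s * sin s) has_real_derivative f s * sin s) (at s within {0..t})"
        by (rule derivative_eq_intros d[OF s] refl)+ (simp add: algebra_simps)
      show "\<bar>f s * sin s\<bar> \<le> \<rho>" by (rule le[OF s]) simp
    qed
    then show ?thesis by (simp add: A_def X_def Y_def x0 y0)
  qed
  have B: "\<bar>B\<bar> \<le> \<rho> * t"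
  proof -
    have "\<bar>(X t * sin t + Y t * cos t) - (X 0 * sin 0 + Y 0 * cos 0)\<bar> \<le> \<rho> * (t - 0)"
    proof (rule deriv_bound_imp_diff_bound[OF t, where h' = "\<lambda>s. - (f s * cos s)"])
      fix s assume s: "s \<in> {0..t}"
      show "((\<lambda>s. X s * sin s + Y s * cos s) has_real_derivative - (f s * cos s)) (at s within {0..t})"
        by (rule derivative_eq_intros d[OF s] refl)+ (simp add: algebra_simps)
      show "\<bar>- (f s * cos s)\<bar> \<le> \<rho>" using le[OF s, of "cos s"] by simp
    qed
    then show ?thesis by (simp add: B_def X_def Y_def x0 y0)
  qed
  have "A * cos t + B * sin t = X t * (sin t * sin t + cos t * cos t)"
    "B * cos t - A * sin t = Y t * (sin t * sin t + cos t * cos t)"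
    unfolding A_def B_def by algebra+
  then have "X t = A * cos t + B * sin t" "Y t = B * cos t - A * sin t"
    unfolding power2_eq_square[symmetric] sin_cos_squared_add by simp_all
  moreover have "\<bar>A * c\<bar> \<le> \<rho> * t" "\<bar>B * c\<bar> \<le> \<rho> * t" if "\<bar>c\<bar> \<le> 1" for c
    using A B that mult_left_le[of "\<bar>c\<bar>" "\<bar>A\<bar>"] mult_left_le[of "\<bar>c\<bar>" "\<bar>B\<bar>"]
    by (auto simp: abs_mult)
  ultimately have "\<bar>X t\<bar> \<le> 2 * (\<rho> * t)" "\<bar>Y t\<bar> \<le> 2 * (\<rho> * t)"
    by (smt (verit) abs_cos_le_one abs_sin_le_one)+
  then show "\<bar>x t - cos t\<bar> \<le> 2 * (\<rho> * t)" "\<bar>y t + sin t\<bar> \<le> 2 * (\<rho> * t)"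
    by (simp_all add: X_def Y_def)
qed

lemma damped_oscillator_exists:
  fixes H :: "real \<Rightarrow> real \<Rightarrow> real"
  assumes cont: "\<And>y. continuous_on {0..} y \<Longrightarrow> continuous_on {0..} (\<lambda>t. H t (y t))"
    and lip: "\<And>t a b. 0 \<le> t \<Longrightarrow> \<bar>H t a - H t b\<bar> \<le> L * \<bar>a - b\<bar>"
    and zero: "\<And>t. 0 \<le> t \<Longrightarrow> H t 0 = 0"
  shows "\<exists>x y. x 0 = x0 \<and> y 0 = y0 \<and> oscillator_on {0..} (\<lambda>t. H t (y t)) x y"
proof -
  define F :: "real \<Rightarrow> real \<times> real \<Rightarrow> real \<times> real" where "F t z = (snd z, - fst z - H t (snd z))" for t z
  have "\<exists>z. z 0 = (x0, y0) \<and> (\<forall>t\<ge>0. (z has_vector_derivative F t (z t)) (at t within {0..}))"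
  proof (rule global_picard)
    fix z :: "real \<Rightarrow> real \<times> real" assume "continuous_on {0..} z"
    then show "continuous_on {0..} (\<lambda>t. F t (z t))"
      unfolding F_def by (intro continuous_intros cont)
  next
    fix t :: real and z w :: "real \<times> real" assume t: "0 \<le> t"
    have "norm (F t z - F t w) \<le> norm (snd z - snd w) + norm (- (fst z - fst w) - (H t (snd z) - H t (snd w)))"
      unfolding F_def by (simp add: norm_Pair_le) (smt (verit) norm_Pair_le real_norm_def)
    also have "\<dots> \<le> \<bar>snd z - snd w\<bar> + \<bar>fst z - fst w\<bar> + \<bar>L\<bar> * \<bar>snd z - snd w\<bar>"
    proof -
      have "L * \<bar>snd z - snd w\<bar> \<le> \<bar>L\<bar> * \<bar>snd z - snd w\<bar>" by (intro mult_right_mono) auto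
      with lip[OF t, of "snd z" "snd w"] show ?thesis by simp
    qed
    also have "\<dots> \<le> norm (z - w) + norm (z - w) + \<bar>L\<bar> * norm (z - w)"
    proof -
      have "\<bar>snd z - snd w\<bar> \<le> norm (z - w)" "\<bar>fst z - fst w\<bar> \<le> norm (z - w)"
        by (metis snd_diff norm_snd_le prod.collapse real_norm_def)
          (metis fst_diff norm_fst_le prod.collapse real_norm_def)
      then show ?thesis by (intro add_mono mult_left_mono) auto
    qed
    finally show "norm (F t z - F t w) \<le> (2 + \<bar>L\<bar>) * norm (z - w)" by (simp add: algebra_simps)
  next
    fix t :: real assume "0 \<le> t"
    then show "norm (F t 0) \<le> 0" by (simp add: F_def zero)
  qed
  then obtain z where z0: "z 0 = (x0, y0)"
    and z: "\<And>t. t \<ge> 0 \<Longrightarrow> (z has_vector_derivative F t (z t)) (at t within {0..})" by blast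
  have "oscillator_on {0..} (\<lambda>t. H t (snd (z t))) (\<lambda>t. fst (z t)) (\<lambda>t. snd (z t))"
    unfolding oscillator_on_def
  proof (intro ballI conjI)
    fix t :: real assume "t \<in> {0..}"
    then have d: "(z has_vector_derivative F t (z t)) (at t within {0..})" by (simp add: z)
    show "((\<lambda>t. fst (z t)) has_real_derivative snd (z t)) (at t within {0..})"
      "((\<lambda>t. snd (z t)) has_real_derivative - fst (z t) - H t (snd (z t))) (at t within {0..})"
      using bounded_linear.has_vector_derivative[OF bounded_linear_fst d]
        bounded_linear.has_vector_derivative[OF bounded_linear_snd d]
      by (simp_all add: F_def has_real_derivative_iff_has_vector_derivative)
  qed
  then show ?thesis using z0 by (intro exI[of _ "\<lambda>t. fst (z t)"] exI[of _ "\<lambda>t. snd (z t)"]) auto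
qed

section \<open>The rescaled motion and its variation\<close>

lemma abs_power_diff_le:
  fixes a b :: real
  assumes "\<bar>a\<bar> \<le> 1" "\<bar>b\<bar> \<le> 1"
  shows "\<bar>\<bar>a\<bar> ^ k - \<bar>b\<bar> ^ k\<bar> \<le> real k * \<bar>a - b\<bar>"
proof -
  have "\<bar>\<bar>a\<bar> ^ k - \<bar>b\<bar> ^ k\<bar> \<le> real k * \<bar>\<bar>a\<bar> - \<bar>b\<bar>\<bar>"
    using norm_power_diff[of "\<bar>a\<bar>" "\<bar>b\<bar>" k] assms by simp
  also have "\<dots> \<le> real k * \<bar>a - b\<bar>" by (intro mult_left_mono) auto
  finally show ?thesis .
qed

lemma abs_power_mult_diff_le:
  fixes a b :: real
  assumes "\<bar>a\<bar> \<le> 1" "\<bar>b\<bar> \<le> 1"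
  shows "\<bar>\<bar>a\<bar> ^ k * a - \<bar>b\<bar> ^ k * b\<bar> \<le> (real k + 1) * \<bar>a - b\<bar>"
proof -
  have "\<bar>a\<bar> ^ k * a - \<bar>b\<bar> ^ k * b = \<bar>a\<bar> ^ k * (a - b) + (\<bar>a\<bar> ^ k - \<bar>b\<bar> ^ k) * b"
    by (simp add: algebra_simps)
  also have "\<bar>\<dots>\<bar> \<le> \<bar>a\<bar> ^ k * \<bar>a - b\<bar> + \<bar>\<bar>a\<bar> ^ k - \<bar>b\<bar> ^ k\<bar> * \<bar>b\<bar>"
    by (rule order_trans[OF abs_triangle_ineq]) (simp add: abs_mult)
  also have "\<bar>a\<bar> ^ k * \<bar>a - b\<bar> \<le> 1 * \<bar>a - b\<bar>"
    using assms by (intro mult_right_mono power_le_one) auto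
  also have "\<bar>\<bar>a\<bar> ^ k - \<bar>b\<bar> ^ k\<bar> * \<bar>b\<bar> \<le> (real k * \<bar>a - b\<bar>) * 1"
    using assms by (intro mult_mono abs_power_diff_le) auto
  finally show ?thesis by (simp add: algebra_simps)
qed

text \<open>
  The friction law is monotone: with \<open>g = (\<lambda>x. \<bar>x\<bar>\<^sup>k)\<close>, split \<open>g a * a - g b * b\<close> symmetrically into
  a part with the mean of \<open>g a\<close> and \<open>g b\<close> and a part with their difference.
\<close>

lemma abs_power_mult_mono:
  fixes a b :: real
  shows "0 \<le> (\<bar>a\<bar> ^ k * a - \<bar>b\<bar> ^ k * b) * (a - b)"
proof -
  have "(\<bar>a\<bar> ^ k * a - \<bar>b\<bar> ^ k * b) * (a - b) \<ge>
      (\<bar>a\<bar> ^ k - \<bar>b\<bar> ^ k) * (\<bar>a\<bar> - \<bar>b\<bar>) * ((\<bar>a\<bar> + \<bar>b\<bar>) / 2)"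
  proof -
    have "(\<bar>a\<bar> ^ k * a - \<bar>b\<bar> ^ k * b) * (a - b) =
        (\<bar>a\<bar> ^ k - \<bar>b\<bar> ^ k) * (a * a - b * b) / 2 + (\<bar>a\<bar> ^ k + \<bar>b\<bar> ^ k) / 2 * ((a - b) * (a - b))"
      by (simp add: field_simps)
    moreover have "0 \<le> (\<bar>a\<bar> ^ k + \<bar>b\<bar> ^ k) / 2 * ((a - b) * (a - b))"
      by (rule mult_nonneg_nonneg[OF _ zero_le_square]) simp
    moreover have "a * a - b * b = (\<bar>a\<bar> - \<bar>b\<bar>) * (\<bar>a\<bar> + \<bar>b\<bar>)"
      by (simp add: algebra_simps flip: abs_mult)
    ultimately show ?thesis by simp
  qed
  moreover have "0 \<le> (\<bar>a\<bar> ^ k - \<bar>b\<bar> ^ k) * (\<bar>a\<bar> - \<bar>b\<bar>)"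
  proof (cases "\<bar>a\<bar> \<le> \<bar>b\<bar>")
    case True
    then show ?thesis using power_mono[OF True, of k] by (intro mult_nonpos_nonpos) auto
  next
    case False
    then show ?thesis using power_mono[of "\<bar>b\<bar>" "\<bar>a\<bar>" k] by (intro mult_nonneg_nonneg) auto
  qed
  ultimately show ?thesis
    by (smt (verit) abs_ge_zero divide_nonneg_pos mult_nonneg_nonneg)
qed

text \<open>
  With \<open>E = \<epsilon> e\<close>, \<open>V = \<epsilon> v\<close> and \<open>\<kappa> = \<nu> \<bar>\<epsilon>\<bar>\<^sup>k\<close>, the pair \<open>(e, v)\<close> is the motion started with unit
  displacement, and \<open>(w, p)\<close> solves the linearised equation along it.
\<close>

locale rescaled_flow =
  fixes k :: nat and \<kappa> :: real and e v w p :: "real \<Rightarrow> real"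
  assumes kap: "0 \<le> \<kappa>"
    and init: "e 0 = 1" "v 0 = 0" "w 0 = 1" "p 0 = 0"
    and ev: "oscillator_on {0..} (\<lambda>t. \<kappa> * \<bar>v t\<bar> ^ k * v t) e v"
    and wp: "oscillator_on {0..} (\<lambda>t. \<kappa> * (real k + 1) * \<bar>v t\<bar> ^ k * p t) w p"

text \<open>
  The friction is only locally Lipschitz. Cutting the velocity off at \<open>1\<close> makes it globally Lipschitz, and the
  energy keeps \<open>\<bar>v\<bar> \<le> 1\<close>, so the cut-off is never active.
\<close>

lemma rescaled_flow_exists:
  assumes kap: "0 \<le> \<kappa>"
  shows "\<exists>e v w p. rescaled_flow k \<kappa> e v w p"
proof -
  define clamp :: "real \<Rightarrow> real" where "clamp a = max (- 1) (min 1 a)" for a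
  have clamp: "\<bar>clamp a\<bar> \<le> 1" "\<bar>clamp a - clamp b\<bar> \<le> \<bar>a - b\<bar>" "clamp 0 = 0"
    "0 \<le> clamp a * a" for a b
    by (auto simp: clamp_def max_def min_def mult_nonneg_nonneg mult_nonpos_nonpos)
  have "\<exists>e v. e 0 = 1 \<and> v 0 = 0 \<and>
      oscillator_on {0..} (\<lambda>t. (\<lambda>t a. \<kappa> * \<bar>clamp a\<bar> ^ k * clamp a) t (v t)) e v"
  proof (rule damped_oscillator_exists)
    fix a b :: real
    have "\<bar>\<kappa> * \<bar>clamp a\<bar> ^ k * clamp a - \<kappa> * \<bar>clamp b\<bar> ^ k * clamp b\<bar> =
        \<kappa> * \<bar>\<bar>clamp a\<bar> ^ k * clamp a - \<bar>clamp b\<bar> ^ k * clamp b\<bar>"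
      using kap by (simp add: abs_mult mult.assoc flip: right_diff_distrib)
    also have "\<dots> \<le> \<kappa> * ((real k + 1) * \<bar>clamp a - clamp b\<bar>)"
      using kap clamp by (intro mult_left_mono abs_power_mult_diff_le) auto
    also have "\<dots> \<le> \<kappa> * ((real k + 1) * \<bar>a - b\<bar>)"
      using kap clamp by (intro mult_left_mono) auto
    finally show "\<bar>\<kappa> * \<bar>clamp a\<bar> ^ k * clamp a - \<kappa> * \<bar>clamp b\<bar> ^ k * clamp b\<bar>
        \<le> (\<kappa> * (real k + 1)) * \<bar>a - b\<bar>" by (simp add: mult.assoc)
  next
    fix y :: "real \<Rightarrow> real" assume "continuous_on {0..} y"
    then show "continuous_on {0..} (\<lambda>t. \<kappa> * \<bar>clamp (y t)\<bar> ^ k * clamp (y t))"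
      unfolding clamp_def by (intro continuous_intros)
  qed (simp add: clamp)
  then obtain e v where init: "e 0 = 1" "v 0 = 0"
    and c: "oscillator_on {0..} (\<lambda>t. \<kappa> * \<bar>clamp (v t)\<bar> ^ k * clamp (v t)) e v" by auto
  have v1: "\<bar>v t\<bar> \<le> 1" if "0 \<le> t" for t
  proof -
    have "(e t)\<^sup>2 + (v t)\<^sup>2 \<le> (e 0)\<^sup>2 + (v 0)\<^sup>2 + 2 * 0 * (t - 0)"
    proof (rule oscillator_energy[OF c])
      fix s assume "s \<in> {0..t}"
      have "0 \<le> (\<kappa> * \<bar>clamp (v s)\<bar> ^ k) * (clamp (v s) * v s)"
        using kap by (intro mult_nonneg_nonneg[OF _ clamp(4)]) auto
      then show "- 0 \<le> \<kappa> * \<bar>clamp (v s)\<bar> ^ k * clamp (v s) * v s" by (simp add: mult.assoc)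
    qed (use that in auto)
    then have "(v t)\<^sup>2 \<le> 1" using init by simp (smt (verit) zero_le_power2)
    then show ?thesis by (simp add: abs_square_le_1)
  qed
  have ev: "oscillator_on {0..} (\<lambda>t. \<kappa> * \<bar>v t\<bar> ^ k * v t) e v"
  proof (rule oscillator_on_cong[OF c])
    fix t :: real assume "t \<in> {0..}"
    then have "\<bar>v t\<bar> \<le> 1" by (intro v1) simp
    then have "v t \<le> 1" "- 1 \<le> v t" by linarith+
    then have "clamp (v t) = v t" by (simp add: clamp_def)
    then show "\<kappa> * \<bar>clamp (v t)\<bar> ^ k * clamp (v t) = \<kappa> * \<bar>v t\<bar> ^ k * v t" by simp
  qed
  have cv: "continuous_on {0..} v"
    by (rule oscillator_on_continuous[OF ev])
  have "\<exists>w p. w 0 = 1 \<and> p 0 = 0 \<and>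
      oscillator_on {0..} (\<lambda>t. (\<lambda>t a. \<kappa> * (real k + 1) * \<bar>v t\<bar> ^ k * a) t (p t)) w p"
  proof (rule damped_oscillator_exists)
    fix y :: "real \<Rightarrow> real" assume "continuous_on {0..} y"
    then show "continuous_on {0..} (\<lambda>t. \<kappa> * (real k + 1) * \<bar>v t\<bar> ^ k * y t)"
      by (intro continuous_intros cv)
  next
    fix t a b :: real assume "0 \<le> t"
    have "\<bar>\<kappa> * (real k + 1) * \<bar>v t\<bar> ^ k * a - \<kappa> * (real k + 1) * \<bar>v t\<bar> ^ k * b\<bar> =
        \<kappa> * (real k + 1) * \<bar>v t\<bar> ^ k * \<bar>a - b\<bar>"
      using kap by (simp add: abs_mult flip: right_diff_distrib)
    also have "\<dots> \<le> \<kappa> * (real k + 1) * 1 * \<bar>a - b\<bar>"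
      using kap v1[OF \<open>0 \<le> t\<close>] by (intro mult_right_mono mult_left_mono power_le_one) auto
    finally show "\<bar>\<kappa> * (real k + 1) * \<bar>v t\<bar> ^ k * a - \<kappa> * (real k + 1) * \<bar>v t\<bar> ^ k * b\<bar> \<le>
        \<kappa> * (real k + 1) * \<bar>a - b\<bar>" by simp
  qed simp
  then obtain w p where "w 0 = 1" "p 0 = 0"
    "oscillator_on {0..} (\<lambda>t. \<kappa> * (real k + 1) * \<bar>v t\<bar> ^ k * p t) w p" by auto
  then have "rescaled_flow k \<kappa> e v w p"
    using init ev kap by (intro rescaled_flow.intro) auto
  then show ?thesis by blast
qed

context rescaled_flow
begin

lemma v_le_1:
  assumes "0 \<le> t" shows "\<bar>v t\<bar> \<le> 1"
proof -
  have "(e t)\<^sup>2 + (v t)\<^sup>2 \<le> (e 0)\<^sup>2 + (v 0)\<^sup>2 + 2 * 0 * (t - 0)"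
    by (rule oscillator_energy[OF ev]) (use assms kap in \<open>auto simp: mult.assoc\<close>)
  then have "(v t)\<^sup>2 \<le> 1" using init by simp (smt (verit) zero_le_power2)
  then show ?thesis by (simp add: abs_square_le_1)
qed

lemma damping_nonneg: "0 \<le> \<kappa> * (real k + 1) * \<bar>v t\<bar> ^ k"
  using kap by auto

lemma damping_le:
  assumes "0 \<le> t" shows "\<kappa> * (real k + 1) * \<bar>v t\<bar> ^ k \<le> \<kappa> * (real k + 1)"
  using mult_left_mono[OF power_le_one[of "\<bar>v t\<bar>" k], of "\<kappa> * (real k + 1)"] v_le_1[OF assms] kap
  by auto

lemma variation_energy_antimono:
  assumes "0 \<le> a" "a \<le> b"
  shows "(w b)\<^sup>2 + (p b)\<^sup>2 \<le> (w a)\<^sup>2 + (p a)\<^sup>2"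
proof -
  have "- 0 \<le> \<kappa> * (real k + 1) * \<bar>v t\<bar> ^ k * p t * p t" for t
    using mult_nonneg_nonneg[OF damping_nonneg[of t] zero_le_square[of "p t"]] by (simp add: mult.assoc)
  then have "(w b)\<^sup>2 + (p b)\<^sup>2 \<le> (w a)\<^sup>2 + (p a)\<^sup>2 + 2 * 0 * (b - a)"
    using assms by (intro oscillator_energy[OF wp]) auto
  then show ?thesis by simp
qed

lemma w_le_1: "\<bar>w t\<bar> \<le> 1" and p_le_1: "\<bar>p t\<bar> \<le> 1" if "0 \<le> t"
proof -
  have "(w t)\<^sup>2 + (p t)\<^sup>2 \<le> 1" using variation_energy_antimono[of 0 t] that init by simp
  then have "(w t)\<^sup>2 \<le> 1" "(p t)\<^sup>2 \<le> 1" by (smt (verit) zero_le_power2)+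
  then show "\<bar>w t\<bar> \<le> 1" "\<bar>p t\<bar> \<le> 1" by (simp_all add: abs_square_le_1)
qed

lemma v_near_sin:
  assumes "0 \<le> t" shows "\<bar>v t + sin t\<bar> \<le> 2 * (\<kappa> * t)"
proof (rule oscillator_perturbation(2)[OF ev])
  fix s assume "s \<in> {0..t}"
  then have "\<bar>\<bar>v s\<bar> ^ k * v s\<bar> \<le> 1"
    using v_le_1[of s] power_le_one[of "\<bar>v s\<bar>" "Suc k"] by (simp add: abs_mult power_abs mult.commute)
  then show "\<bar>\<kappa> * \<bar>v s\<bar> ^ k * v s\<bar> \<le> \<kappa>"
    using kap mult_left_mono[of "\<bar>\<bar>v s\<bar> ^ k * v s\<bar>" 1 \<kappa>] by (simp add: abs_mult mult.assoc)
qed (use assms init in auto)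

lemma variation_forcing_le:
  assumes "0 \<le> t" shows "\<bar>\<kappa> * (real k + 1) * \<bar>v t\<bar> ^ k * p t\<bar> \<le> \<kappa> * (real k + 1)"
proof -
  have "\<bar>\<kappa> * (real k + 1) * \<bar>v t\<bar> ^ k * p t\<bar> = (\<kappa> * (real k + 1) * \<bar>v t\<bar> ^ k) * \<bar>p t\<bar>"
    using kap by (simp add: abs_mult)
  also have "\<dots> \<le> (\<kappa> * (real k + 1)) * 1"
    by (rule mult_mono[OF damping_le[OF assms] p_le_1[OF assms]]) (use kap in auto)
  finally show ?thesis by simp
qed

lemma w_near_cos: "\<bar>w t - cos t\<bar> \<le> 2 * (\<kappa> * (real k + 1) * t)"
  and p_near_sin: "\<bar>p t + sin t\<bar> \<le> 2 * (\<kappa> * (real k + 1) * t)" if "0 \<le> t"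
  using oscillator_perturbation[OF wp, of t "\<kappa> * (real k + 1)"] that init variation_forcing_le
  by auto

end

section \<open>The depth of the first trough\<close>

lemma one_minus_cos_ge:
  fixes r :: real
  assumes "\<bar>r\<bar> \<le> pi"
  shows "r\<^sup>2 / 18 \<le> 1 - cos r"
proof -
  define x where "x = \<bar>r\<bar> / 2"
  have x: "0 \<le> x" "x \<le> 2" using assms pi_half_less_two by (auto simp: x_def)
  have "\<bar>sin x - (\<Sum>m<3. sin_coeff m * x ^ m)\<bar> \<le> inverse (fact 3) * \<bar>x\<bar> ^ 3"
    by (rule Maclaurin_sin_bound)
  then have "\<bar>sin x - x\<bar> \<le> x ^ 3 / 6"
    using x by (simp add: eval_nat_numeral sin_coeff_def field_simps)
  moreover have "x ^ 3 \<le> x * 4"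
    using x mult_left_mono[OF power_mono[of x 2 2] x(1)] by (simp add: eval_nat_numeral)
  ultimately have "x / 3 \<le> sin x" by linarith
  then have "(x / 3)\<^sup>2 \<le> (sin x)\<^sup>2" using x by (intro power_mono) auto
  moreover have "cos r = 1 - 2 * (sin x)\<^sup>2"
  proof -
    have "cos r = cos (2 * x)" by (simp add: x_def)
    then show ?thesis by (simp add: cos_double_sin)
  qed
  moreover have "(x / 3)\<^sup>2 = r\<^sup>2 / 36" by (simp add: x_def power_divide)
  ultimately show ?thesis by simp
qed

text \<open>
  The supremum over all times, rather than the value at the first minimum, makes the dichotomy of smoothness and
  blow-up immediate.
\<close>

definition trough :: "(real \<Rightarrow> real) \<Rightarrow> real" where
  "trough w = (SUP t\<in>{0..}. - w t)"

definition wallis :: "nat \<Rightarrow> real" where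
  "wallis n = integral {0..pi} (\<lambda>t. sin t ^ n)"

lemma wallis_pos: "0 < wallis n"
proof -
  have c: "continuous_on {0..pi} (\<lambda>t. sin t ^ n)" by (intro continuous_intros)
  have nn: "0 \<le> sin t ^ n" if "t \<in> {0..pi}" for t
    using that by (simp add: sin_ge_zero)
  have "0 \<le> wallis n" unfolding wallis_def
    by (rule integral_nonneg[OF integrable_continuous_real[OF c]]) (use nn in auto)
  moreover have "wallis n \<noteq> 0"
  proof
    assume "wallis n = 0"
    then have "\<forall>t\<in>{0..pi}. sin t ^ n = 0"
      unfolding wallis_def using integral_eq_0_iff[OF c _ nn] by simp
    then have "sin (pi / 2) ^ n = 0" by (rule bspec) simp
    then show False by simp
  qed
  ultimately show ?thesis by simp
qed

context rescaled_flow
begin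

lemma trough_upper:
  assumes "0 \<le> t" shows "- w t \<le> trough w"
  unfolding trough_def
  by (rule cSUP_upper2[where x = t])
    (use assms w_le_1 in \<open>auto intro!: bdd_aboveI[where M = 1] simp: abs_le_iff\<close>)

lemma trough_le_1: "trough w \<le> 1"
  unfolding trough_def by (rule cSUP_least) (use w_le_1 in \<open>auto simp: abs_le_iff\<close>)

text \<open>
  Later minima are no deeper than the first one: at a zero \<open>\<tau>\<close> of \<open>p\<close> near \<open>\<pi>\<close> all the energy sits in
  \<open>w \<tau> < 0\<close>, and it never grows again. This reduces the supremum to a bounded time
  interval, where solutions can be compared uniformly.
\<close>

lemma trough_within_turn:
  assumes small: "\<kappa> * (real k + 1) \<le> 1 / 32" and t: "0 \<le> t"
  shows "\<exists>s\<in>{0..3 * pi / 2}. - w t \<le> - w s"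
proof -
  define K where "K = \<kappa> * (real k + 1)"
  have K: "0 \<le> K" "K \<le> 1 / 32" using kap small by (auto simp: K_def)
  \<comment> \<open>Up to \<open>3\<pi>/2\<close>, which is less than \<open>6\<close>, the bound \<open>1/32\<close> keeps \<open>w\<close> and \<open>p\<close> within \<open>3/8\<close> of
    \<open>cos\<close> and \<open>- sin\<close>.\<close>
  have err: "2 * (K * s) \<le> 3 / 8" if "0 \<le> s" "s \<le> 3 * pi / 2" for s
  proof -
    have "K * s \<le> 1 / 32 * 6" using K that pi_less_4 by (intro mult_mono) auto
    then show ?thesis by simp
  qed
  have near: "\<bar>w s - cos s\<bar> \<le> 3 / 8" "\<bar>p s + sin s\<bar> \<le> 3 / 8" if "0 \<le> s" "s \<le> 3 * pi / 2" for s
    using w_near_cos[of s] p_near_sin[of s] err[OF that] that unfolding K_def by auto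
  have s32: "sin (3 * pi / 2) = - 1" using sin_3over2_pi by (simp add: mult.commute)
  have "\<exists>\<tau>. pi / 2 \<le> \<tau> \<and> \<tau> \<le> 3 * pi / 2 \<and> p \<tau> = 0"
  proof (rule IVT')
    show "p (pi / 2) \<le> 0" using abs_le_D1[OF near(2)[of "pi / 2"]] by simp
    show "0 \<le> p (3 * pi / 2)" using abs_le_D2[OF near(2)[of "3 * pi / 2"]] s32 by simp
    show "continuous_on {pi / 2..3 * pi / 2} p"
      by (rule continuous_on_subset[OF oscillator_on_continuous(2)[OF wp]]) (auto intro: order_trans[of 0 "pi/2"])
  qed auto
  then obtain \<tau> where \<tau>: "pi / 2 \<le> \<tau>" "\<tau> \<le> 3 * pi / 2" "p \<tau> = 0" by blast
  have \<tau>0: "0 \<le> \<tau>" using \<tau>(1) pi_ge_zero by linarith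
  \<comment> \<open>At \<open>\<tau>\<close> the cosine is nonpositive; were \<open>w \<tau>\<close> positive, both sine and cosine would be small.\<close>
  have "w \<tau> \<le> 0"
  proof (rule ccontr)
    assume "\<not> w \<tau> \<le> 0"
    have "0 \<le> sin (\<tau> - pi / 2)" using \<tau> by (intro sin_ge_zero) auto
    then have "cos \<tau> \<le> 0" by (simp add: sin_diff)
    then have "\<bar>cos \<tau>\<bar> \<le> 3 / 8" using near(1)[OF \<tau>0 \<tau>(2)] \<open>\<not> w \<tau> \<le> 0\<close> by linarith
    moreover have "\<bar>sin \<tau>\<bar> \<le> 3 / 8" using near(2)[OF \<tau>0 \<tau>(2)] \<tau>(3) by simp
    ultimately have "(sin \<tau>)\<^sup>2 + (cos \<tau>)\<^sup>2 \<le> (3 / 8)\<^sup>2 + (3 / 8)\<^sup>2"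
      by (intro add_mono) (metis abs_ge_zero power2_abs power_mono)+
    then show False unfolding sin_cos_squared_add by (simp add: power2_eq_square)
  qed
  show ?thesis
  proof (cases "t \<le> \<tau>")
    case True
    then show ?thesis using t \<tau> by auto
  next
    case False
    then have "(w t)\<^sup>2 \<le> (w \<tau>)\<^sup>2"
      using variation_energy_antimono[OF \<tau>0, of t] \<tau>(3) by simp (smt (verit) zero_le_power2)
    then have "\<bar>w t\<bar> \<le> \<bar>w \<tau>\<bar>" by (simp add: abs_le_square_iff)
    then show ?thesis using \<open>w \<tau> \<le> 0\<close> \<tau> \<tau>0 by (intro bexI[of _ \<tau>]) auto
  qed
qed

lemma trough_least:
  assumes "\<kappa> * (real k + 1) \<le> 1 / 32" and "\<And>t. 0 \<le> t \<Longrightarrow> t \<le> 3 * pi / 2 \<Longrightarrow> - w t \<le> c"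
  shows "trough w \<le> c"
  unfolding trough_def
proof (rule cSUP_least)
  fix t :: real assume "t \<in> {0..}"
  then show "- w t \<le> c" using trough_within_turn[OF assms(1), of t] assms(2) by force
qed auto

text \<open>
  The quantity \<open>w cos - p sin\<close>, equal to \<open>1\<close> at \<open>0\<close> and to \<open>- w \<pi>\<close> at \<open>\<pi>\<close>, has derivative
  \<open>K \<bar>v\<bar>\<^sup>k p sin\<close> with \<open>K = \<kappa> (k + 1)\<close>. Since \<open>v\<close> and \<open>p\<close> differ from \<open>- sin\<close> by \<open>O(K)\<close>, this
  is \<open>- K sin\<^sup>k\<^sup>+\<^sup>2\<close> up to \<open>O(K\<^sup>2)\<close>.
\<close>

lemma w_pi_expansion:
  "\<bar>- w pi - 1 + \<kappa> * (real k + 1) * wallis (k + 2)\<bar> \<le> 4 * (pi * (\<kappa> * (real k + 1)))\<^sup>2"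
proof -
  define K where "K = \<kappa> * (real k + 1)"
  have K: "0 \<le> K" "real k * \<kappa> \<le> K" using kap by (auto simp: K_def algebra_simps)
  define J where "J t = integral {0..t} (\<lambda>t. sin t ^ (k + 2))" for t :: real
  have dJ: "(J has_real_derivative sin t ^ (k + 2)) (at t within {0..pi})" if "t \<in> {0..pi}" for t
    unfolding J_def using that by (intro integral_has_real_derivative continuous_intros)
  have "oscillator_on {0..pi} (\<lambda>t. K * \<bar>v t\<bar> ^ k * p t) w p"
    using oscillator_on_subset[OF wp, of "{0..pi}"] unfolding K_def by auto
  then have d: "(w has_real_derivative p t) (at t within {0..pi})"
      "(p has_real_derivative - w t - K * \<bar>v t\<bar> ^ k * p t) (at t within {0..pi})" if "t \<in> {0..pi}" for t
    using that unfolding oscillator_on_def by auto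
  have "\<bar>(w pi * cos pi - p pi * sin pi + K * J pi) - (w 0 * cos 0 - p 0 * sin 0 + K * J 0)\<bar>
      \<le> (4 * pi * K\<^sup>2) * (pi - 0)"
  proof (rule deriv_bound_imp_diff_bound[where h' = "\<lambda>t. K * (\<bar>v t\<bar> ^ k * p t + sin t ^ (k + 1)) * sin t"])
    fix t assume t: "t \<in> {0..pi}"
    show "((\<lambda>t. w t * cos t - p t * sin t + K * J t) has_real_derivative
        K * (\<bar>v t\<bar> ^ k * p t + sin t ^ (k + 1)) * sin t) (at t within {0..pi})"
      by (rule derivative_eq_intros d[OF t] dJ[OF t] refl)+ (simp add: algebra_simps)
    have t0: "0 \<le> t" "t \<le> pi" and s0: "0 \<le> sin t" using t by (auto simp: sin_ge_zero)
    have "\<bar>v t\<bar> ^ k * p t + sin t ^ (k + 1) =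
        (\<bar>v t\<bar> ^ k - \<bar>- sin t\<bar> ^ k) * p t + \<bar>sin t\<bar> ^ k * (p t + sin t)"
      using s0 by (simp add: algebra_simps)
    also have "\<bar>\<dots>\<bar> \<le> \<bar>\<bar>v t\<bar> ^ k - \<bar>- sin t\<bar> ^ k\<bar> * \<bar>p t\<bar> + \<bar>sin t\<bar> ^ k * \<bar>p t + sin t\<bar>"
      by (rule order_trans[OF abs_triangle_ineq]) (simp add: abs_mult)
    also have "\<bar>\<bar>v t\<bar> ^ k - \<bar>- sin t\<bar> ^ k\<bar> * \<bar>p t\<bar> \<le> (real k * \<bar>v t - - sin t\<bar>) * 1"
      using v_le_1[OF t0(1)] p_le_1[OF t0(1)] by (intro mult_mono abs_power_diff_le) auto
    also have "real k * \<bar>v t - - sin t\<bar> \<le> real k * (2 * (\<kappa> * t))"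
      using v_near_sin[OF t0(1)] by (intro mult_left_mono) auto
    also have "\<bar>sin t\<bar> ^ k * \<bar>p t + sin t\<bar> \<le> 1 * (2 * (K * t))"
      using p_near_sin[OF t0(1)] unfolding K_def by (intro mult_mono power_le_one) auto
    also have "real k * (2 * (\<kappa> * t)) = 2 * ((real k * \<kappa>) * t)" by simp
    also have "(real k * \<kappa>) * t \<le> K * t" using K t0 by (intro mult_right_mono) auto
    also have "2 * (K * t) * 1 + 1 * (2 * (K * t)) \<le> 4 * (pi * K)"
      using mult_left_mono[OF t0(2) K(1)] by (simp add: mult.commute)
    finally have "\<bar>\<bar>v t\<bar> ^ k * p t + sin t ^ (k + 1)\<bar> \<le> 4 * (pi * K)" by simp
    then have "K * \<bar>\<bar>v t\<bar> ^ k * p t + sin t ^ (k + 1)\<bar> * \<bar>sin t\<bar> \<le> K * (4 * (pi * K)) * 1"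
      using K by (intro mult_mono mult_left_mono) auto
    then show "\<bar>K * (\<bar>v t\<bar> ^ k * p t + sin t ^ (k + 1)) * sin t\<bar> \<le> 4 * pi * K\<^sup>2"
      using K by (simp add: abs_mult power2_eq_square mult.assoc mult.left_commute)
  qed simp
  then show ?thesis
    unfolding K_def[symmetric]
    by (simp add: init J_def wallis_def power2_eq_square algebra_simps)
qed

text \<open>
  On \<open>[0, 3\<pi>/2]\<close> the value \<open>- w t\<close> exceeds \<open>- w \<pi>\<close> by at most \<open>b \<bar>t - \<pi>\<bar> - (1 + cos t)\<close>, where
  \<open>b = O(K)\<close> bounds the derivative of \<open>w - cos\<close>. The second term is at least \<open>(t - \<pi>)\<^sup>2 / 18\<close>, so
  completing the square bounds the excess by a multiple of \<open>b\<^sup>2\<close>: the exact position of the minimum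
  is irrelevant to first order.
\<close>

lemma trough_expansion:
  assumes small: "\<kappa> * (real k + 1) \<le> 1 / 32"
  shows "\<bar>trough w - 1 + \<kappa> * (real k + 1) * wallis (k + 2)\<bar> \<le> 45 * (pi * (\<kappa> * (real k + 1)))\<^sup>2"
proof -
  define b where "b = 3 * (pi * (\<kappa> * (real k + 1)))"
  have "- w t \<le> - w pi + 9 / 2 * b\<^sup>2" if t: "0 \<le> t" "t \<le> 3 * pi / 2" for t
  proof -
    have d: "((\<lambda>s. w s - cos s) has_real_derivative p s + sin s) (at s within {0..3 * pi / 2})"
      if "s \<in> {0..3 * pi / 2}" for s
    proof -
      have "(w has_real_derivative p s) (at s within {0..3 * pi / 2})"
        using oscillator_on_subset[OF wp, of "{0..3 * pi / 2}"] that unfolding oscillator_on_def by auto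
      then show ?thesis by (auto intro!: derivative_eq_intros)
    qed
    have bd: "\<bar>p s + sin s\<bar> \<le> b" if "s \<in> {0..3 * pi / 2}" for s
    proof -
      have "\<kappa> * (real k + 1) * s \<le> \<kappa> * (real k + 1) * (3 * pi / 2)"
        using that kap by (intro mult_left_mono) auto
      then show ?thesis using p_near_sin[of s] that by (simp add: b_def algebra_simps)
    qed
    have "\<bar>(w t - cos t) - (w pi - cos pi)\<bar> \<le> b * \<bar>t - pi\<bar>"
    proof (cases "t \<le> pi")
      case True
      have "\<bar>(w pi - cos pi) - (w t - cos t)\<bar> \<le> b * (pi - t)"
        by (rule deriv_bound_imp_diff_bound[OF True, where h' = "\<lambda>s. p s + sin s"])
          (use t in \<open>auto intro!: DERIV_subset[OF d] bd\<close>)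
      then show ?thesis using True by (simp add: abs_minus_commute)
    next
      case False
      have "\<bar>(w t - cos t) - (w pi - cos pi)\<bar> \<le> b * (t - pi)"
        by (rule deriv_bound_imp_diff_bound[where h' = "\<lambda>s. p s + sin s"])
          (use t False in \<open>auto intro!: DERIV_subset[OF d] bd\<close>)
      then show ?thesis using False by simp
    qed
    moreover have "cos (t - pi) = - cos t" by (simp add: cos_diff)
    then have "(t - pi)\<^sup>2 / 18 \<le> 1 + cos t"
      using one_minus_cos_ge[of "t - pi"] t by (simp add: abs_le_iff)
    moreover have "b * \<bar>t - pi\<bar> - (t - pi)\<^sup>2 / 18 \<le> 9 / 2 * b\<^sup>2"
    proof -
      have "0 \<le> (\<bar>t - pi\<bar> - 9 * b)\<^sup>2 / 18" by simp
      also have "\<dots> = (t - pi)\<^sup>2 / 18 - b * \<bar>t - pi\<bar> + 9 / 2 * b\<^sup>2"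
        by (simp add: power2_diff power_mult_distrib field_simps)
      finally show ?thesis by simp
    qed
    ultimately show ?thesis by (simp add: abs_le_iff)
  qed
  then have "trough w \<le> - w pi + 9 / 2 * b\<^sup>2" by (rule trough_least[OF small])
  moreover have "9 / 2 * b\<^sup>2 \<le> 41 * (pi * (\<kappa> * (real k + 1)))\<^sup>2"
    unfolding b_def by (simp add: power_mult_distrib)
  moreover have "- w pi \<le> trough w" by (rule trough_upper) simp
  ultimately show ?thesis using w_pi_expansion by linarith
qed

lemma trough_ge: "1 - 2 * (pi * (\<kappa> * (real k + 1))) \<le> trough w"
  using trough_upper[of pi] w_near_cos[of pi] by (simp add: algebra_simps)

lemma trough_pos:
  assumes small: "\<kappa> * (real k + 1) \<le> 1 / 32"
  shows "0 < trough w"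
proof -
  have "pi * (\<kappa> * (real k + 1)) \<le> 4 * (1 / 32)" using small kap pi_less_4 by (intro mult_mono) auto
  then show ?thesis using trough_ge by linarith
qed

end

text \<open>
  Energy inequality for the difference of two motions, then for that of their variations. The monotone part
  of the friction has the good sign; what remains is controlled by \<open>\<bar>\<kappa>\<^sub>1 - \<kappa>\<^sub>2\<bar>\<close> and,
  for the variations, by the distance of the two velocities as well.
\<close>

lemma variation_dependence:
  assumes f1: "rescaled_flow k \<kappa>\<^sub>1 e\<^sub>1 v\<^sub>1 w\<^sub>1 p\<^sub>1" and f2: "rescaled_flow k \<kappa>\<^sub>2 e\<^sub>2 v\<^sub>2 w\<^sub>2 p\<^sub>2"
    and t: "0 \<le> t" "t \<le> T"
  shows "\<bar>w\<^sub>1 t - w\<^sub>2 t\<bar> \<le> sqrt (4 * T * ((real k + 1) *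
      (\<bar>\<kappa>\<^sub>1 - \<kappa>\<^sub>2\<bar> + \<kappa>\<^sub>1 * (real k * sqrt (4 * T * \<bar>\<kappa>\<^sub>1 - \<kappa>\<^sub>2\<bar>)))))"
proof -
  interpret f1: rescaled_flow k \<kappa>\<^sub>1 e\<^sub>1 v\<^sub>1 w\<^sub>1 p\<^sub>1 by (rule f1)
  interpret f2: rescaled_flow k \<kappa>\<^sub>2 e\<^sub>2 v\<^sub>2 w\<^sub>2 p\<^sub>2 by (rule f2)
  define \<Delta> where "\<Delta> = \<bar>\<kappa>\<^sub>1 - \<kappa>\<^sub>2\<bar>"
  have vd: "\<bar>v\<^sub>1 s - v\<^sub>2 s\<bar> \<le> sqrt (4 * T * \<Delta>)" if s: "0 \<le> s" "s \<le> T" for s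
  proof -
    have "(e\<^sub>1 s - e\<^sub>2 s)\<^sup>2 + (v\<^sub>1 s - v\<^sub>2 s)\<^sup>2 \<le>
        (e\<^sub>1 0 - e\<^sub>2 0)\<^sup>2 + (v\<^sub>1 0 - v\<^sub>2 0)\<^sup>2 + 2 * (2 * \<Delta>) * (s - 0)"
    proof (rule oscillator_energy[OF oscillator_on_diff[OF f1.ev f2.ev]])
      fix r assume r: "r \<in> {0..s}"
      have "(\<kappa>\<^sub>1 * \<bar>v\<^sub>1 r\<bar> ^ k * v\<^sub>1 r - \<kappa>\<^sub>2 * \<bar>v\<^sub>2 r\<bar> ^ k * v\<^sub>2 r) * (v\<^sub>1 r - v\<^sub>2 r) =
          \<kappa>\<^sub>1 * ((\<bar>v\<^sub>1 r\<bar> ^ k * v\<^sub>1 r - \<bar>v\<^sub>2 r\<bar> ^ k * v\<^sub>2 r) * (v\<^sub>1 r - v\<^sub>2 r)) +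
          (\<kappa>\<^sub>1 - \<kappa>\<^sub>2) * (\<bar>v\<^sub>2 r\<bar> ^ k * v\<^sub>2 r * (v\<^sub>1 r - v\<^sub>2 r))"
        by (simp add: algebra_simps)
      moreover have "0 \<le> \<kappa>\<^sub>1 * ((\<bar>v\<^sub>1 r\<bar> ^ k * v\<^sub>1 r - \<bar>v\<^sub>2 r\<bar> ^ k * v\<^sub>2 r) * (v\<^sub>1 r - v\<^sub>2 r))"
        by (intro mult_nonneg_nonneg f1.kap abs_power_mult_mono)
      moreover have "\<bar>(\<kappa>\<^sub>1 - \<kappa>\<^sub>2) * (\<bar>v\<^sub>2 r\<bar> ^ k * v\<^sub>2 r * (v\<^sub>1 r - v\<^sub>2 r))\<bar> \<le> \<Delta> * (1 * 1 * 2)"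
        unfolding abs_mult \<Delta>_def
        using f1.v_le_1[of r] f2.v_le_1[of r] r
        by (intro mult_mono) (auto intro!: power_le_one)
      ultimately show "- (2 * \<Delta>) \<le>
          (\<kappa>\<^sub>1 * \<bar>v\<^sub>1 r\<bar> ^ k * v\<^sub>1 r - \<kappa>\<^sub>2 * \<bar>v\<^sub>2 r\<bar> ^ k * v\<^sub>2 r) * (v\<^sub>1 r - v\<^sub>2 r)"
        by linarith
    qed (use s in auto)
    also have "\<dots> \<le> 4 * T * \<Delta>"
      using mult_right_mono[of s T \<Delta>] s by (simp add: f1.init f2.init \<Delta>_def mult.commute)
    finally have "(v\<^sub>1 s - v\<^sub>2 s)\<^sup>2 \<le> 4 * T * \<Delta>" by (smt (verit) zero_le_power2)
    then show ?thesis by (rule real_le_rsqrt[of "\<bar>v\<^sub>1 s - v\<^sub>2 s\<bar>", simplified])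
  qed
  define D where "D = (real k + 1) * (\<Delta> + \<kappa>\<^sub>1 * (real k * sqrt (4 * T * \<Delta>)))"
  have D0: "0 \<le> D" using t f1.kap by (auto simp: D_def \<Delta>_def)
  have "(w\<^sub>1 t - w\<^sub>2 t)\<^sup>2 + (p\<^sub>1 t - p\<^sub>2 t)\<^sup>2 \<le>
      (w\<^sub>1 0 - w\<^sub>2 0)\<^sup>2 + (p\<^sub>1 0 - p\<^sub>2 0)\<^sup>2 + 2 * (2 * D) * (t - 0)"
  proof (rule oscillator_energy[OF oscillator_on_diff[OF f1.wp f2.wp]])
    fix r assume r: "r \<in> {0..t}"
    define c\<^sub>1 c\<^sub>2 where "c\<^sub>1 = \<kappa>\<^sub>1 * (real k + 1) * \<bar>v\<^sub>1 r\<bar> ^ k" and "c\<^sub>2 = \<kappa>\<^sub>2 * (real k + 1) * \<bar>v\<^sub>2 r\<bar> ^ k"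
    have "c\<^sub>1 - c\<^sub>2 = (real k + 1) * ((\<kappa>\<^sub>1 - \<kappa>\<^sub>2) * \<bar>v\<^sub>2 r\<bar> ^ k + \<kappa>\<^sub>1 * (\<bar>v\<^sub>1 r\<bar> ^ k - \<bar>v\<^sub>2 r\<bar> ^ k))"
      by (simp add: c\<^sub>1_def c\<^sub>2_def algebra_simps)
    also have "\<bar>\<dots>\<bar> \<le> (real k + 1) * (\<bar>\<kappa>\<^sub>1 - \<kappa>\<^sub>2\<bar> * \<bar>v\<^sub>2 r\<bar> ^ k + \<kappa>\<^sub>1 * \<bar>\<bar>v\<^sub>1 r\<bar> ^ k - \<bar>v\<^sub>2 r\<bar> ^ k\<bar>)"
      unfolding abs_mult using f1.kap
      by (intro mult_mono order_trans[OF abs_triangle_ineq]) (auto simp: abs_mult)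
    also have "\<dots> \<le> (real k + 1) * (\<Delta> * 1 + \<kappa>\<^sub>1 * (real k * \<bar>v\<^sub>1 r - v\<^sub>2 r\<bar>))"
      using f1.v_le_1[of r] f2.v_le_1[of r] r f1.kap unfolding \<Delta>_def
      by (intro mult_left_mono add_mono abs_power_diff_le power_le_one) auto
    also have "\<dots> \<le> D"
      unfolding D_def using vd[of r] r t f1.kap
      by (simp only: mult_1_right) (intro mult_left_mono add_left_mono, auto)
    finally have c: "\<bar>c\<^sub>1 - c\<^sub>2\<bar> \<le> D" .
    have "(c\<^sub>1 * p\<^sub>1 r - c\<^sub>2 * p\<^sub>2 r) * (p\<^sub>1 r - p\<^sub>2 r) =
        c\<^sub>1 * ((p\<^sub>1 r - p\<^sub>2 r) * (p\<^sub>1 r - p\<^sub>2 r)) + (c\<^sub>1 - c\<^sub>2) * (p\<^sub>2 r * (p\<^sub>1 r - p\<^sub>2 r))"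
      by (simp add: algebra_simps)
    moreover have "0 \<le> c\<^sub>1 * ((p\<^sub>1 r - p\<^sub>2 r) * (p\<^sub>1 r - p\<^sub>2 r))"
      unfolding c\<^sub>1_def by (rule mult_nonneg_nonneg[OF f1.damping_nonneg zero_le_square])
    moreover have "\<bar>(c\<^sub>1 - c\<^sub>2) * (p\<^sub>2 r * (p\<^sub>1 r - p\<^sub>2 r))\<bar> \<le> D * (1 * 2)"
      unfolding abs_mult using c D0 f1.p_le_1[of r] f2.p_le_1[of r] r
      by (intro mult_mono) auto
    ultimately have "- (2 * D) \<le> (c\<^sub>1 * p\<^sub>1 r - c\<^sub>2 * p\<^sub>2 r) * (p\<^sub>1 r - p\<^sub>2 r)" by linarith
    then show "- (2 * D) \<le> (\<kappa>\<^sub>1 * (real k + 1) * \<bar>v\<^sub>1 r\<bar> ^ k * p\<^sub>1 r -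
        \<kappa>\<^sub>2 * (real k + 1) * \<bar>v\<^sub>2 r\<bar> ^ k * p\<^sub>2 r) * (p\<^sub>1 r - p\<^sub>2 r)"
      by (simp add: c\<^sub>1_def c\<^sub>2_def)
  qed (use t in auto)
  also have "\<dots> \<le> 4 * T * D"
    using mult_right_mono[of t T D] t D0 by (simp add: f1.init f2.init mult.commute)
  finally have "(w\<^sub>1 t - w\<^sub>2 t)\<^sup>2 \<le> 4 * T * D" by (smt (verit) zero_le_power2)
  then show ?thesis unfolding D_def \<Delta>_def by (rule real_le_rsqrt[of "\<bar>w\<^sub>1 t - w\<^sub>2 t\<bar>", simplified])
qed

definition variation :: "nat \<Rightarrow> real \<Rightarrow> real \<Rightarrow> real" where
  "variation k \<kappa> = (SOME w. \<exists>e v p. rescaled_flow k \<kappa> e v w p)"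

lemma variation_flow:
  assumes "0 \<le> \<kappa>"
  obtains e v p where "rescaled_flow k \<kappa> e v (variation k \<kappa>) p"
proof -
  have "\<exists>w e v p. rescaled_flow k \<kappa> e v w p" using rescaled_flow_exists[OF assms, of k] by blast
  from someI_ex[OF this] that show ?thesis unfolding variation_def by blast
qed

definition depth :: "nat \<Rightarrow> real \<Rightarrow> real" where
  "depth k \<kappa> = trough (variation k \<kappa>)"

lemma depth_continuous:
  "continuous_on {\<kappa>. 0 \<le> \<kappa> \<and> \<kappa> * (real k + 1) \<le> 1 / 32} (depth k)"
  unfolding continuous_on
proof
  let ?S = "{\<kappa>. 0 \<le> \<kappa> \<and> \<kappa> * (real k + 1) \<le> 1 / 32}"
  fix \<kappa> assume \<kappa>: "\<kappa> \<in> ?S"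
  define T where "T = 3 * pi / 2"
  define \<omega> where "\<omega> \<kappa>' = sqrt (4 * T * ((real k + 1) *
      (\<bar>\<kappa> - \<kappa>'\<bar> + \<kappa> * (real k * sqrt (4 * T * \<bar>\<kappa> - \<kappa>'\<bar>)))))" for \<kappa>'
  have le: "\<bar>depth k \<kappa>' - depth k \<kappa>\<bar> \<le> \<omega> \<kappa>'" if \<kappa>': "\<kappa>' \<in> ?S" for \<kappa>'
  proof -
    obtain e\<^sub>1 v\<^sub>1 p\<^sub>1 where f1: "rescaled_flow k \<kappa> e\<^sub>1 v\<^sub>1 (variation k \<kappa>) p\<^sub>1"
      using variation_flow \<kappa> by blast
    obtain e\<^sub>2 v\<^sub>2 p\<^sub>2 where f2: "rescaled_flow k \<kappa>' e\<^sub>2 v\<^sub>2 (variation k \<kappa>') p\<^sub>2"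
      using variation_flow \<kappa>' by blast
    interpret f1: rescaled_flow k \<kappa> e\<^sub>1 v\<^sub>1 "variation k \<kappa>" p\<^sub>1 by (rule f1)
    interpret f2: rescaled_flow k \<kappa>' e\<^sub>2 v\<^sub>2 "variation k \<kappa>'" p\<^sub>2 by (rule f2)
    have close: "\<bar>variation k \<kappa> t - variation k \<kappa>' t\<bar> \<le> \<omega> \<kappa>'" if "0 \<le> t" "t \<le> T" for t
      unfolding \<omega>_def by (rule variation_dependence[OF f1 f2 that])
    have "depth k \<kappa> \<le> depth k \<kappa>' + \<omega> \<kappa>'"
      unfolding depth_def
    proof (rule f1.trough_least)
      fix t :: real assume "0 \<le> t" "t \<le> 3 * pi / 2"
      then show "- variation k \<kappa> t \<le> trough (variation k \<kappa>') + \<omega> \<kappa>'"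
        using close[of t] f2.trough_upper[of t] by (auto simp: T_def)
    qed (use \<kappa> in auto)
    moreover have "depth k \<kappa>' \<le> depth k \<kappa> + \<omega> \<kappa>'"
      unfolding depth_def
    proof (rule f2.trough_least)
      fix t :: real assume "0 \<le> t" "t \<le> 3 * pi / 2"
      then show "- variation k \<kappa>' t \<le> trough (variation k \<kappa>) + \<omega> \<kappa>'"
        using close[of t] f1.trough_upper[of t] by (auto simp: T_def)
    qed (use \<kappa>' in auto)
    ultimately show ?thesis by linarith
  qed
  have "((\<lambda>\<kappa>'. depth k \<kappa>' - depth k \<kappa>) \<longlongrightarrow> 0) (at \<kappa> within ?S)"
  proof (rule Lim_null_comparison)
    show "\<forall>\<^sub>F \<kappa>' in at \<kappa> within ?S. norm (depth k \<kappa>' - depth k \<kappa>) \<le> \<omega> \<kappa>'"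
      using le by (auto simp: eventually_at_filter)
    have "continuous_on UNIV \<omega>" unfolding \<omega>_def by (intro continuous_intros)
    then have "(\<omega> \<longlongrightarrow> \<omega> \<kappa>) (at \<kappa> within ?S)"
      by (meson UNIV_I continuous_on tendsto_within_subset top_greatest)
    then show "(\<omega> \<longlongrightarrow> 0) (at \<kappa> within ?S)" by (simp add: \<omega>_def)
  qed
  then show "(depth k \<longlongrightarrow> depth k \<kappa>) (at \<kappa> within ?S)" by (rule LIM_zero_cancel)
qed

section \<open>From the depth to the threshold\<close>

text \<open>
  With \<open>x = 1 - M\<close> one has \<open>1 / (1 + M) - 1/2 - x / 4 = x\<^sup>2 / (4 (2 - x))\<close>, and \<open>x \<le> 2 b\<close>.
\<close>

lemma trough_to_threshold:
  fixes M :: real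
  assumes M: "0 < M" "M \<le> 1" and lin: "\<bar>M - 1 + L\<bar> \<le> 45 * b\<^sup>2" and low: "1 - 2 * b \<le> M"
  shows "\<bar>1 / (1 + M) - 1 / 2 - L / 4\<bar> \<le> 13 * b\<^sup>2"
proof -
  define x where "x = 1 - M"
  have x: "0 \<le> x" "x < 1" "x \<le> 2 * b" using M low by (auto simp: x_def)
  have "1 / (1 + M) - 1 / 2 - x / 4 = x\<^sup>2 / (4 * (2 - x))"
    using x by (simp add: x_def field_simps power2_eq_square)
  moreover have "x\<^sup>2 / (4 * (2 - x)) \<le> x\<^sup>2 / 4"
    using x by (intro divide_left_mono) auto
  moreover have "0 \<le> x\<^sup>2 / (4 * (2 - x))" using x by simp
  moreover have "x\<^sup>2 \<le> (2 * b)\<^sup>2" using x by (intro power_mono) auto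
  then have "x\<^sup>2 / 4 \<le> b\<^sup>2" by (simp add: power_mult_distrib)
  moreover have "\<bar>x / 4 - L / 4\<bar> \<le> 45 / 4 * b\<^sup>2"
  proof -
    have "x / 4 - L / 4 = - ((M - 1 + L) / 4)" by (simp add: x_def field_simps)
    then show ?thesis using lin by (simp only: abs_minus_cancel abs_divide) simp
  qed
  moreover have "0 \<le> b\<^sup>2" by simp
  ultimately show ?thesis by (simp only: abs_le_iff) linarith
qed

section \<open>Smoothness and blow-up in terms of the variation\<close>

lemma ep_solution_from_variation:
  assumes fl: "rescaled_flow k (\<nu> * \<bar>\<epsilon>\<bar> ^ k) e v w p" and s0: "s0 < 1" and J: "J \<subseteq> {0..}"
    and pos: "\<And>t. t \<in> J \<Longrightarrow> 0 < 1 + s0 / (1 - s0) * w t"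
  shows "ep_solution_on J \<nu> k s0 \<epsilon> (\<lambda>t. \<epsilon> * v t) (\<lambda>t. \<epsilon> * e t)
    (\<lambda>t. s0 / (1 - s0) * p t / (1 + s0 / (1 - s0) * w t))
    (\<lambda>t. 1 - 1 / (1 + s0 / (1 - s0) * w t))"
proof -
  interpret rescaled_flow k "\<nu> * \<bar>\<epsilon>\<bar> ^ k" e v w p by (rule fl)
  define l where "l = s0 / (1 - s0)"
  have l1: "1 + l = 1 / (1 - s0)" using s0 by (simp add: l_def field_simps)
  have dev: "(e has_real_derivative v t) (at t within J)"
    "(v has_real_derivative - e t - \<nu> * \<bar>\<epsilon>\<bar> ^ k * \<bar>v t\<bar> ^ k * v t) (at t within J)" if "t \<in> J" for t
    using oscillator_on_subset[OF ev J] that by (auto simp: oscillator_on_def)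
  have dwp: "(w has_real_derivative p t) (at t within J)"
    "(p has_real_derivative - w t - \<nu> * \<bar>\<epsilon>\<bar> ^ k * (real k + 1) * \<bar>v t\<bar> ^ k * p t) (at t within J)"
    if "t \<in> J" for t
    using oscillator_on_subset[OF wp J] that by (auto simp: oscillator_on_def)
  show ?thesis
    unfolding ep_solution_on_def l_def[symmetric]
  proof (intro conjI ballI)
    fix t assume t: "t \<in> J"
    define y where "y = 1 + l * w t"
    have y: "0 < y" using pos[OF t] by (simp add: y_def l_def)
    have lw: "l * w t = y - 1" by (simp add: y_def)
    show "((\<lambda>t. \<epsilon> * v t) has_real_derivative - (\<epsilon> * e t) - \<nu> * \<bar>\<epsilon> * v t\<bar> ^ k * (\<epsilon> * v t)) (at t within J)"
      by (rule derivative_eq_intros dev[OF t] refl)+ (simp add: abs_mult power_mult_distrib algebra_simps)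
    show "((\<lambda>t. \<epsilon> * e t) has_real_derivative \<epsilon> * v t) (at t within J)"
      by (rule derivative_eq_intros dev[OF t] refl)+ simp
    define c where "c = \<nu> * (real k + 1) * \<bar>\<epsilon> * v t\<bar> ^ k"
    have c: "\<nu> * \<bar>\<epsilon>\<bar> ^ k * (real k + 1) * \<bar>v t\<bar> ^ k = c"
      by (simp add: c_def abs_mult power_mult_distrib algebra_simps)
    have "((\<lambda>t. l * p t / (1 + l * w t)) has_real_derivative
        ((l * (- w t - c * p t)) * y - l * p t * (l * p t)) / (y * y)) (at t within J)"
      using y by (auto intro!: derivative_eq_intros dwp[OF t] simp: y_def c)
    also have "((l * (- w t - c * p t)) * y - l * p t * (l * p t)) / (y * y) =
        - (1 - 1 / y) - (l * p t / y)\<^sup>2 - c * (l * p t / y)"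
    proof -
      have "(l * (- w t - c * p t)) * y = (- (y - 1) - c * (l * p t)) * y"
        unfolding lw[symmetric] by (simp add: algebra_simps)
      then show ?thesis using y by (simp add: power2_eq_square diff_divide_distrib left_diff_distrib)
    qed
    finally show "((\<lambda>t. l * p t / (1 + l * w t)) has_real_derivative
        - (1 - 1 / (1 + l * w t)) - (l * p t / (1 + l * w t))\<^sup>2 -
        \<nu> * (real k + 1) * \<bar>\<epsilon> * v t\<bar> ^ k * (l * p t / (1 + l * w t))) (at t within J)"
      unfolding y_def c_def .
    have "((\<lambda>t. 1 - 1 / (1 + l * w t)) has_real_derivative l * p t / (y * y)) (at t within J)"
      using y by (auto intro!: derivative_eq_intros dwp[OF t] simp: y_def)
    also have "l * p t / (y * y) = l * p t / y - l * p t / y * (1 - 1 / y)"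
      using y by (simp add: field_simps)
    finally show "((\<lambda>t. 1 - 1 / (1 + l * w t)) has_real_derivative
        l * p t / (1 + l * w t) - l * p t / (1 + l * w t) * (1 - 1 / (1 + l * w t))) (at t within J)"
      unfolding y_def .
  qed (use s0 in \<open>simp_all add: init l1\<close>)
qed

text \<open>
  The substitution can be applied to every solution: \<open>s\<close> cannot cross \<open>1\<close>, because \<open>1 - s\<close> solves the linear
  equation \<open>z' = - q z\<close>, so \<open>X = 1 / (1 - s) - 1\<close> and \<open>P = q / (1 - s)\<close> are defined throughout. They satisfy the
  linearised equation, and the energy inequality identifies them with \<open>(\<lambda> w, \<lambda> p)\<close>,
  where \<open>\<lambda> = s\<^sub>0 / (1 - s\<^sub>0)\<close>.
\<close>

lemma ep_solution_eq_variation: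
  assumes fl: "rescaled_flow k (\<nu> * \<bar>\<epsilon>\<bar> ^ k) e v w p" and \<nu>: "0 \<le> \<nu>" and s0: "s0 < 1"
    and sol: "ep_solution_on J \<nu> k s0 \<epsilon> V E q s" and t: "0 \<le> t" and J: "{0..t} \<subseteq> J" and J0: "J \<subseteq> {0..}"
  shows "s t < 1" "1 / (1 - s t) = 1 + s0 / (1 - s0) * w t"
proof -
  interpret rescaled_flow k "\<nu> * \<bar>\<epsilon>\<bar> ^ k" e v w p by (rule fl)
  have init': "V 0 = 0" "E 0 = \<epsilon>" "q 0 = 0" "s 0 = s0"
    using sol unfolding ep_solution_on_def by auto
  have d: "(V has_real_derivative (- E u - \<nu> * \<bar>V u\<bar> ^ k * V u)) (at u within {0..t})"
    "(E has_real_derivative V u) (at u within {0..t})"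
    "(q has_real_derivative (- s u - (q u)\<^sup>2 - \<nu> * (real k + 1) * \<bar>V u\<bar> ^ k * q u)) (at u within {0..t})"
    "(s has_real_derivative (q u - q u * s u)) (at u within {0..t})" if "u \<in> {0..t}" for u
    using sol that J unfolding ep_solution_on_def by (blast intro: DERIV_subset)+
  have s1: "s u < 1" if u: "u \<in> {0..t}" for u
  proof -
    have cq: "continuous_on {0..t} q" by (rule DERIV_continuous_on[OF d(3)])
    define Q where "Q u = integral {0..u} q" for u
    have dQ: "(Q has_real_derivative q u) (at u within {0..t})" if "u \<in> {0..t}" for u
      unfolding Q_def by (rule integral_has_real_derivative[OF cq that])
    have "\<bar>(1 - s u) * exp (Q u) - (1 - s 0) * exp (Q 0)\<bar> \<le> 0 * (u - 0)"
    proof (rule deriv_bound_imp_diff_bound[where h' = "\<lambda>_. 0"])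
      fix r assume r: "r \<in> {0..u}"
      then have r': "r \<in> {0..t}" using u by auto
      have "((\<lambda>r. (1 - s r) * exp (Q r)) has_real_derivative 0) (at r within {0..t})"
        by (rule derivative_eq_intros d(4)[OF r'] dQ[OF r'] refl)+ (simp add: algebra_simps)
      then show "((\<lambda>r. (1 - s r) * exp (Q r)) has_real_derivative 0) (at r within {0..u})"
        by (rule DERIV_subset) (use u in auto)
    qed (use u in auto)
    then have "(1 - s u) * exp (Q u) = (1 - s0)" by (simp add: init' Q_def)
    then show ?thesis using s0 by (metis diff_gt_0_iff_gt exp_gt_zero zero_less_mult_pos2)
  qed
  show "s t < 1" using s1 t by simp
  have EV: "oscillator_on {0..t} (\<lambda>u. \<nu> * \<bar>V u\<bar> ^ k * V u) E V"
    unfolding oscillator_on_def using d(1,2) by auto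
  have evt: "oscillator_on {0..t} (\<lambda>u. \<nu> * \<bar>\<epsilon> * v u\<bar> ^ k * (\<epsilon> * v u)) (\<lambda>u. \<epsilon> * e u) (\<lambda>u. \<epsilon> * v u)"
    by (rule oscillator_on_cong[OF oscillator_on_scale[OF oscillator_on_subset[OF ev]]])
      (auto simp: abs_mult power_mult_distrib)
  have V: "V u = \<epsilon> * v u" if u: "u \<in> {0..t}" for u
  proof -
    have "(E u - \<epsilon> * e u)\<^sup>2 + (V u - \<epsilon> * v u)\<^sup>2 \<le>
        (E 0 - \<epsilon> * e 0)\<^sup>2 + (V 0 - \<epsilon> * v 0)\<^sup>2 + 2 * 0 * (u - 0)"
    proof (rule oscillator_energy[OF oscillator_on_diff[OF EV evt]])
      fix r
      show "- 0 \<le> (\<nu> * \<bar>V r\<bar> ^ k * V r - \<nu> * \<bar>\<epsilon> * v r\<bar> ^ k * (\<epsilon> * v r)) * (V r - \<epsilon> * v r)"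
        using mult_nonneg_nonneg[OF \<nu> abs_power_mult_mono[of "V r" k "\<epsilon> * v r"]]
        by (simp add: algebra_simps)
    qed (use u in auto)
    then show ?thesis by (simp add: init init' sum_power2_le_zero_iff)
  qed
  define l where "l = s0 / (1 - s0)"
  define c where "c u = \<nu> * (real k + 1) * \<bar>V u\<bar> ^ k" for u
  define X P where "X u = 1 / (1 - s u) - 1" and "P u = q u / (1 - s u)" for u
  have XP: "oscillator_on {0..t} (\<lambda>u. c u * P u) X P"
    unfolding oscillator_on_def
  proof (intro ballI conjI)
    fix u assume u: "u \<in> {0..t}"
    have pos: "1 - s u > 0" using s1[OF u] by simp
    have "(X has_real_derivative (q u - q u * s u) / ((1 - s u) * (1 - s u))) (at u within {0..t})"
      unfolding X_def[abs_def] using pos by (auto intro!: derivative_eq_intros d[OF u])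
    also have "(q u - q u * s u) / ((1 - s u) * (1 - s u)) = P u"
    proof -
      have "q u - q u * s u = q u * (1 - s u)" by (simp add: algebra_simps)
      then show ?thesis using pos by (simp add: P_def)
    qed
    finally show "(X has_real_derivative P u) (at u within {0..t})" .
    have "(P has_real_derivative ((- s u - (q u)\<^sup>2 - c u * q u) * (1 - s u) + q u * (q u - q u * s u)) /
        ((1 - s u) * (1 - s u))) (at u within {0..t})"
      unfolding P_def[abs_def] c_def using pos
      by (auto intro!: derivative_eq_intros d[OF u]) (simp add: algebra_simps)
    also have "((- s u - (q u)\<^sup>2 - c u * q u) * (1 - s u) + q u * (q u - q u * s u)) /
        ((1 - s u) * (1 - s u)) = - X u - c u * P u"
    proof -
      have "(- s u - (q u)\<^sup>2 - c u * q u) * (1 - s u) + q u * (q u - q u * s u) =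
          (- s u - c u * q u) * (1 - s u)" by (simp add: power2_eq_square algebra_simps)
      then have "((- s u - (q u)\<^sup>2 - c u * q u) * (1 - s u) + q u * (q u - q u * s u)) /
          ((1 - s u) * (1 - s u)) = (- s u - c u * q u) / (1 - s u)"
        using pos by (simp only:) simp
      also have "\<dots> = - (s u / (1 - s u)) - c u * P u"
        by (simp add: P_def diff_divide_distrib)
      also have "s u / (1 - s u) = X u" using pos by (simp add: X_def field_simps)
      finally show ?thesis .
    qed
    finally show "(P has_real_derivative - X u - c u * P u) (at u within {0..t})" .
  qed
  have wpt: "oscillator_on {0..t} (\<lambda>u. c u * (l * p u)) (\<lambda>u. l * w u) (\<lambda>u. l * p u)"
  proof (rule oscillator_on_cong[OF oscillator_on_scale[OF oscillator_on_subset[OF wp]]])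
    fix u assume "u \<in> {0..t}"
    then show "l * (\<nu> * \<bar>\<epsilon>\<bar> ^ k * (real k + 1) * \<bar>v u\<bar> ^ k * p u) = c u * (l * p u)"
      by (simp add: c_def V abs_mult power_mult_distrib)
  qed auto
  have "(X t - l * w t)\<^sup>2 + (P t - l * p t)\<^sup>2 \<le>
      (X 0 - l * w 0)\<^sup>2 + (P 0 - l * p 0)\<^sup>2 + 2 * 0 * (t - 0)"
  proof (rule oscillator_energy[OF oscillator_on_diff[OF XP wpt]])
    fix r
    have "0 \<le> c r * ((P r - l * p r) * (P r - l * p r))"
      unfolding c_def using \<nu> by (intro mult_nonneg_nonneg zero_le_square) auto
    then show "- 0 \<le> (c r * P r - c r * (l * p r)) * (P r - l * p r)" by (simp add: algebra_simps)
  qed (use t in auto)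
  moreover have "X 0 = l" using s0 by (simp add: X_def init' l_def field_simps)
  ultimately have "X t = l * w t"
    by (simp add: init init' P_def sum_power2_le_zero_iff)
  then show "1 / (1 - s t) = 1 + s0 / (1 - s0) * w t" by (simp add: X_def l_def)
qed

lemma globally_smooth_imp_variation_pos:
  assumes fl: "rescaled_flow k (\<nu> * \<bar>\<epsilon>\<bar> ^ k) e v w p" and \<nu>: "0 \<le> \<nu>" and s0: "s0 < 1"
    and gs: "globally_smooth \<nu> k s0 \<epsilon>" and t: "0 \<le> t"
  shows "0 < 1 + s0 / (1 - s0) * w t"
proof -
  obtain V E q s where sol: "ep_solution_on {0..} \<nu> k s0 \<epsilon> V E q s"
    using gs unfolding globally_smooth_def by blast
  have "s t < 1" "1 / (1 - s t) = 1 + s0 / (1 - s0) * w t"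
    using ep_solution_eq_variation[OF fl \<nu> s0 sol t] by auto
  then show ?thesis by (metis diff_gt_0_iff_gt zero_less_divide_1_iff)
qed

text \<open>
  As \<open>s\<close> becomes infinite, \<open>1 + \<lambda> w = 1 / (1 - s)\<close> tends to \<open>0\<close>, and \<open>w\<close> is continuous beyond the blow-up time.
\<close>

lemma blows_up_imp_variation_zero:
  assumes fl: "rescaled_flow k (\<nu> * \<bar>\<epsilon>\<bar> ^ k) e v w p" and \<nu>: "0 \<le> \<nu>" and s0: "s0 < 1"
    and bu: "blows_up \<nu> k s0 \<epsilon>"
  shows "\<exists>T>0. 1 + s0 / (1 - s0) * w T = 0"
proof -
  interpret rescaled_flow k "\<nu> * \<bar>\<epsilon>\<bar> ^ k" e v w p by (rule fl)
  obtain T V E q s where T: "T > 0" and sol: "ep_solution_on {0..<T} \<nu> k s0 \<epsilon> V E q s"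
    and inf: "filterlim s at_infinity (at_left T)"
    using bu unfolding blows_up_def by blast
  have "filterlim (\<lambda>t. 1 + - s t) at_infinity (at_left T)"
    by (rule tendsto_add_filterlim_at_infinity[OF tendsto_const])
      (use inf in \<open>simp add: filterlim_at_infinity_conv_norm_at_top\<close>)
  then have "((\<lambda>t. inverse (1 + - s t)) \<longlongrightarrow> 0) (at_left T)"
    by (rule filterlim_compose[OF tendsto_inverse_0])
  moreover have "\<forall>\<^sub>F t in at_left T. inverse (1 + - s t) = 1 + s0 / (1 - s0) * w t"
  proof (rule eventually_at_leftI[OF _ T])
    fix t assume "t \<in> {0<..<T}"
    then have "1 / (1 - s t) = 1 + s0 / (1 - s0) * w t"
      by (intro ep_solution_eq_variation(2)[OF fl \<nu> s0 sol]) auto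
    then show "inverse (1 + - s t) = 1 + s0 / (1 - s0) * w t" by (simp add: inverse_eq_divide)
  qed
  ultimately have "((\<lambda>t. 1 + s0 / (1 - s0) * w t) \<longlongrightarrow> 0) (at_left T)"
    by (rule Lim_transform_eventually)
  moreover have "isCont w T"
    using continuous_on_interior[OF oscillator_on_continuous(1)[OF wp]] T by simp
  then have "(w \<longlongrightarrow> w T) (at_left T)"
    unfolding isCont_def by (rule filterlim_mono) (auto simp: at_le)
  then have "((\<lambda>t. 1 + s0 / (1 - s0) * w t) \<longlongrightarrow> 1 + s0 / (1 - s0) * w T) (at_left T)"
    by (intro tendsto_intros)
  ultimately show ?thesis using T tendsto_unique[OF trivial_limit_at_left_real] by blast
qed

lemma not_globally_smooth_and_blows_up:
  assumes "0 \<le> \<nu>" "s0 < 1" "globally_smooth \<nu> k s0 \<epsilon>"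
  shows "\<not> blows_up \<nu> k s0 \<epsilon>"
proof
  assume bu: "blows_up \<nu> k s0 \<epsilon>"
  obtain e v p where fl: "rescaled_flow k (\<nu> * \<bar>\<epsilon>\<bar> ^ k) e v (variation k (\<nu> * \<bar>\<epsilon>\<bar> ^ k)) p"
    using variation_flow[of "\<nu> * \<bar>\<epsilon>\<bar> ^ k" k] assms(1) by auto
  obtain T where "T > 0" "1 + s0 / (1 - s0) * variation k (\<nu> * \<bar>\<epsilon>\<bar> ^ k) T = 0"
    using blows_up_imp_variation_zero[OF fl assms(1,2) bu] by blast
  then show False
    using globally_smooth_imp_variation_pos[OF fl assms, of T] by simp
qed

lemma globally_smooth_if_shallow:
  assumes \<nu>: "0 \<le> \<nu>" and s0: "0 \<le> s0" "s0 < 1"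
    and sub: "s0 / (1 - s0) * depth k (\<nu> * \<bar>\<epsilon>\<bar> ^ k) < 1"
  shows "globally_smooth \<nu> k s0 \<epsilon>"
proof -
  define w where "w = variation k (\<nu> * \<bar>\<epsilon>\<bar> ^ k)"
  obtain e v p where fl: "rescaled_flow k (\<nu> * \<bar>\<epsilon>\<bar> ^ k) e v w p"
    using variation_flow[of "\<nu> * \<bar>\<epsilon>\<bar> ^ k" k] \<nu> unfolding w_def by auto
  interpret rescaled_flow k "\<nu> * \<bar>\<epsilon>\<bar> ^ k" e v w p by (rule fl)
  have "0 < 1 + s0 / (1 - s0) * w t" if "0 \<le> t" for t
  proof -
    have "s0 / (1 - s0) * - w t \<le> s0 / (1 - s0) * trough w"
      using trough_upper[OF that] s0 by (intro mult_left_mono) auto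
    then show ?thesis using sub unfolding depth_def w_def[symmetric] by linarith
  qed
  then show ?thesis
    using ep_solution_from_variation[OF fl s0(2), of "{0..}"] unfolding globally_smooth_def by auto
qed

text \<open>
  Let \<open>T\<close> be the first zero of \<open>y = 1 + \<lambda> w\<close>. Then \<open>s = 1 - 1 / y\<close> is infinite at \<open>T\<close>, and so is
  \<open>q = \<lambda> p / y\<close> provided \<open>p T \<noteq> 0\<close>. If \<open>p T\<close> vanished, all the energy at \<open>T\<close> would sit in
  \<open>w T = - 1 / \<lambda>\<close>, and \<open>w\<close> could never fall below that value, although it does.
\<close>

lemma blows_up_if_deep:
  assumes \<nu>: "0 \<le> \<nu>" and s0: "0 < s0" "s0 < 1"
    and super: "1 < s0 / (1 - s0) * depth k (\<nu> * \<bar>\<epsilon>\<bar> ^ k)"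
  shows "blows_up \<nu> k s0 \<epsilon>"
proof -
  define w where "w = variation k (\<nu> * \<bar>\<epsilon>\<bar> ^ k)"
  obtain e v p where fl: "rescaled_flow k (\<nu> * \<bar>\<epsilon>\<bar> ^ k) e v w p"
    using variation_flow[of "\<nu> * \<bar>\<epsilon>\<bar> ^ k" k] \<nu> unfolding w_def by auto
  interpret rescaled_flow k "\<nu> * \<bar>\<epsilon>\<bar> ^ k" e v w p by (rule fl)
  define l where "l = s0 / (1 - s0)"
  have l: "0 < l" using s0 by (simp add: l_def)
  define y where "y t = 1 + l * w t" for t
  have cw: "continuous_on {0..} w" and cp: "continuous_on {0..} p"
    using oscillator_on_continuous[OF wp] by auto
  have cy: "continuous_on {0..} y" unfolding y_def by (intro continuous_intros cw)
  have "1 / l < (SUP t\<in>{0..}. - w t)"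
    using super l unfolding depth_def trough_def w_def[symmetric] l_def[symmetric]
    by (simp add: field_simps)
  then obtain t where t: "0 \<le> t" "1 / l < - w t"
    by (subst (asm) less_cSUP_iff)
      (use w_le_1 in \<open>auto intro!: bdd_aboveI[where M = 1] simp: abs_le_iff\<close>)
  then have yt: "y t < 0" using l by (simp add: y_def field_simps)
  have y0: "0 < y 0" using l by (simp add: y_def init)
  have zero_before: "\<exists>r. 0 \<le> r \<and> r \<le> u \<and> y r = 0" if "0 \<le> u" "y u \<le> 0" for u
    using that y0 by (intro IVT2' continuous_on_subset[OF cy]) auto
  define Z where "Z = {u \<in> {0..t}. y u = 0}"
  have "closed Z"
    unfolding Z_def
    by (rule continuous_closed_preimage_constant) (auto intro: continuous_on_subset[OF cy])
  moreover have "bounded Z" by (rule bounded_subset[of "{0..t}"]) (auto simp: Z_def)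
  ultimately have "compact Z" by (simp add: compact_eq_bounded_closed)
  moreover have "Z \<noteq> {}" using zero_before[of t] t yt unfolding Z_def by auto
  ultimately obtain T where T: "T \<in> Z" "\<And>u. u \<in> Z \<Longrightarrow> T \<le> u"
    using compact_attains_inf by metis
  have T0: "0 < T" and Tt: "T \<le> t" and yT: "y T = 0"
    using T(1) y0 unfolding Z_def by (auto simp: less_le)
  have pos: "0 < y u" if "u \<in> {0..<T}" for u
  proof (rule ccontr)
    assume "\<not> 0 < y u"
    then obtain r where "0 \<le> r" "r \<le> u" "y r = 0" using zero_before[of u] \<open>u \<in> {0..<T}\<close> by auto
    then have "T \<le> r" using T(2)[of r] Tt that unfolding Z_def by auto
    then show False using \<open>r \<le> u\<close> that by simp
  qed
  have sol: "ep_solution_on {0..<T} \<nu> k s0 \<epsilon> (\<lambda>t. \<epsilon> * v t) (\<lambda>t. \<epsilon> * e t)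
      (\<lambda>t. l * p t / y t) (\<lambda>t. 1 - 1 / y t)"
    unfolding y_def l_def using pos unfolding y_def l_def
    by (intro ep_solution_from_variation[OF fl s0(2)]) auto
  have pT: "p T \<noteq> 0"
  proof
    assume "p T = 0"
    then have "(w t)\<^sup>2 \<le> (w T)\<^sup>2"
      using variation_energy_antimono[of T t] T0 Tt by simp (smt (verit) zero_le_power2)
    then have "\<bar>w t\<bar> \<le> \<bar>w T\<bar>" by (simp add: abs_le_square_iff)
    moreover have "w T = - (1 / l)" using yT l by (simp add: y_def field_simps)
    ultimately show False using t l by simp
  qed
  have left: "(f \<longlongrightarrow> f T) (at_left T)" if "continuous_on {0..} f" for f :: "real \<Rightarrow> real"
  proof -
    have "isCont f T" using continuous_on_interior[OF that] T0 by simp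
    then show ?thesis unfolding isCont_def by (rule filterlim_mono) (auto simp: at_le)
  qed
  have "filterlim y (at 0) (at_left T)"
    unfolding filterlim_at
  proof
    show "\<forall>\<^sub>F t in at_left T. y t \<in> UNIV \<and> y t \<noteq> 0"
    proof (rule eventually_at_leftI[OF _ T0])
      fix u assume "u \<in> {0<..<T}"
      then show "y u \<in> UNIV \<and> y u \<noteq> 0" using pos[of u] by simp
    qed
    show "(y \<longlongrightarrow> 0) (at_left T)" using left[OF cy] yT by simp
  qed
  then have yinf: "filterlim (\<lambda>t. inverse (y t)) at_infinity (at_left T)"
    by (rule filterlim_compose[OF filterlim_inverse_at_infinity])
  have "filterlim (\<lambda>t. (l * p t) * inverse (y t)) at_infinity (at_left T)"
    by (rule tendsto_mult_filterlim_at_infinity[OF _ _ yinf, of _ "l * p T"])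
      (use l pT in \<open>auto intro!: tendsto_intros left[OF cp]\<close>)
  moreover have "filterlim (\<lambda>t. 1 + - inverse (y t)) at_infinity (at_left T)"
    by (rule tendsto_add_filterlim_at_infinity[OF tendsto_const])
      (use yinf in \<open>simp add: filterlim_at_infinity_conv_norm_at_top\<close>)
  ultimately show ?thesis
    unfolding blows_up_def using T0 sol by (auto simp: divide_inverse intro!: exI[of _ T] exI conjI)
qed


section \<open>The threshold curve near the equilibrium\<close>

text \<open>
  Continuity of \<open>g\<close> makes the two sides of its graph open, so that a point off the graph has a
  neighbourhood free of one of the two sets; points on the graph are approached horizontally.
\<close>

lemma closures_meet_in_graph:
  fixes g :: "real \<Rightarrow> real" and A B :: "(real \<times> real) set"
  assumes I: "open I" and R: "open R" and g: "continuous_on R g"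
    and below: "\<And>x y. x \<in> I \<Longrightarrow> y \<in> R \<Longrightarrow> x < g y \<Longrightarrow> (x, y) \<in> A \<and> (x, y) \<notin> B"
    and above: "\<And>x y. x \<in> I \<Longrightarrow> y \<in> R \<Longrightarrow> g y < x \<Longrightarrow> (x, y) \<in> B \<and> (x, y) \<notin> A"
  shows "closure A \<inter> closure B \<inter> (I \<times> R) = {(x, y). x = g y} \<inter> (I \<times> R)"
proof -
  have U: "open (I \<times> R)" using I R by (rule open_Times)
  have c: "continuous_on (I \<times> R) (\<lambda>z. fst z - g (snd z))"
    by (intro continuous_intros continuous_on_compose2[OF g]) auto
  define Lo Hi where "Lo = (I \<times> R) \<inter> (\<lambda>z. fst z - g (snd z)) -` {..<0}"
    and "Hi = (I \<times> R) \<inter> (\<lambda>z. fst z - g (snd z)) -` {0<..}"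
  have "open Lo" "open Hi"
    unfolding Lo_def Hi_def
    by (intro continuous_open_preimage[OF c U] open_lessThan open_greaterThan)+
  moreover have "Lo \<inter> B = {}" "Hi \<inter> A = {}"
    using below above by (auto simp: Lo_def Hi_def)
  ultimately have emp: "Lo \<inter> closure B = {}" "Hi \<inter> closure A = {}"
    by (simp_all add: open_Int_closure_eq_empty)
  have sub: "closure A \<inter> closure B \<inter> (I \<times> R) \<subseteq> {(x, y). x = g y}"
  proof clarsimp
    fix x y assume xy: "(x, y) \<in> closure A" "(x, y) \<in> closure B" "x \<in> I" "y \<in> R"
    then have "(x, y) \<notin> Lo" "(x, y) \<notin> Hi" using emp by auto
    then show "x = g y" using xy by (auto simp: Lo_def Hi_def)
  qed
  have "(g y, y) \<in> closure A \<and> (g y, y) \<in> closure B" if y: "g y \<in> I" "y \<in> R" for y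
  proof -
    obtain d where d: "d > 0" "\<And>x. dist x (g y) < d \<Longrightarrow> x \<in> I"
      using I y(1) unfolding open_dist by blast
    show ?thesis unfolding closure_approachable
    proof (intro conjI allI impI)
      fix r :: real assume r: "r > 0"
      define \<eta> where "\<eta> = min d r / 2"
      have \<eta>: "0 < \<eta>" "\<eta> < d" "\<eta> < r" using d r by (auto simp: \<eta>_def)
      have "(g y - \<eta>, y) \<in> A" "(g y + \<eta>, y) \<in> B"
        using below[OF d(2) y(2), of "g y - \<eta>"] above[OF d(2) y(2), of "g y + \<eta>"] \<eta>
        by (auto simp: dist_real_def)
      then show "\<exists>z\<in>A. dist z (g y, y) < r" "\<exists>z\<in>B. dist z (g y, y) < r"
        using \<eta> by (auto intro!: bexI simp: dist_Pair_Pair dist_real_def)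
    qed
  qed
  with sub show ?thesis by auto
qed

lemma remainder_smallo_power:
  fixes f :: "real \<Rightarrow> real"
  assumes k: "1 \<le> k" and r: "0 < r"
    and bd: "\<And>\<epsilon>. \<bar>\<epsilon>\<bar> < r \<Longrightarrow> \<bar>f \<epsilon>\<bar> \<le> B * (\<bar>\<epsilon>\<bar> ^ k)\<^sup>2"
  shows "f \<in> o[at 0](\<lambda>\<epsilon>. \<epsilon> ^ k)"
proof (rule landau_o.smallI)
  fix c :: real assume c: "c > 0"
  have "((\<lambda>\<epsilon>. B * \<bar>\<epsilon>\<bar> ^ k) \<longlongrightarrow> B * \<bar>0\<bar> ^ k) (at 0)"
    by (intro tendsto_intros)
  then have "\<forall>\<^sub>F \<epsilon> in at 0. B * \<bar>\<epsilon>\<bar> ^ k < c"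
    using k c by (intro order_tendstoD(2)) (auto simp: power_0_left)
  moreover have "\<forall>\<^sub>F \<epsilon> in at (0 :: real). \<bar>\<epsilon>\<bar> < r"
    using r unfolding eventually_at by (intro exI[of _ r]) auto
  ultimately show "\<forall>\<^sub>F \<epsilon> in at 0. norm (f \<epsilon>) \<le> c * norm (\<epsilon> ^ k)"
  proof eventually_elim
    case (elim \<epsilon>)
    have "norm (f \<epsilon>) \<le> (B * \<bar>\<epsilon>\<bar> ^ k) * \<bar>\<epsilon>\<bar> ^ k"
      using bd[OF elim(2)] by (simp add: power2_eq_square mult.assoc)
    also have "\<dots> \<le> c * \<bar>\<epsilon>\<bar> ^ k" using elim(1) by (intro mult_right_mono) auto
    finally show ?case by (simp add: power_abs)
  qed
qed

theorem theorem3: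
  fixes m k :: nat
  assumes "m \<ge> 1" and "k = 2 * m"
  shows "\<exists>C::real. C > 0 \<and>
    (\<forall>\<nu>\<^sub>0::real. \<nu>\<^sub>0 > 0 \<longrightarrow>
      (\<exists>(U :: (real \<times> real) set) (\<delta> :: real \<Rightarrow> real).
         open U \<and> (1/2, 0) \<in> U \<and> U \<subseteq> {(s\<^sub>0, E\<^sub>0). s\<^sub>0 < 1} \<and>
         threshold_curve \<nu>\<^sub>0 k \<inter> U = {(s\<^sub>0, \<epsilon>). s\<^sub>0 - 1/2 = \<delta> \<epsilon>} \<inter> U \<and>
         (\<forall>(s\<^sub>0, \<epsilon>) \<in> U.
            (s\<^sub>0 - 1/2 < \<delta> \<epsilon> \<longrightarrow> globally_smooth \<nu>\<^sub>0 k s\<^sub>0 \<epsilon>) \<and>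
            (s\<^sub>0 - 1/2 > \<delta> \<epsilon> \<longrightarrow> blows_up \<nu>\<^sub>0 k s\<^sub>0 \<epsilon>)) \<and>
         (\<lambda>\<epsilon>. \<delta> \<epsilon> - \<nu>\<^sub>0 * C * \<epsilon> ^ k) \<in> o[at 0](\<lambda>\<epsilon>. \<epsilon> ^ k)))"
proof -
  define C where "C = (real k + 1) * wallis (k + 2) / 4"
  have k1: "1 \<le> k" and evk: "even k" using assms by auto
  have "\<exists>(U :: (real \<times> real) set) (\<delta> :: real \<Rightarrow> real).
         open U \<and> (1/2, 0) \<in> U \<and> U \<subseteq> {(s\<^sub>0, E\<^sub>0). s\<^sub>0 < 1} \<and>
         threshold_curve \<nu> k \<inter> U = {(s\<^sub>0, \<epsilon>). s\<^sub>0 - 1/2 = \<delta> \<epsilon>} \<inter> U \<and>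
         (\<forall>(s\<^sub>0, \<epsilon>) \<in> U.
            (s\<^sub>0 - 1/2 < \<delta> \<epsilon> \<longrightarrow> globally_smooth \<nu> k s\<^sub>0 \<epsilon>) \<and>
            (s\<^sub>0 - 1/2 > \<delta> \<epsilon> \<longrightarrow> blows_up \<nu> k s\<^sub>0 \<epsilon>)) \<and>
         (\<lambda>\<epsilon>. \<delta> \<epsilon> - \<nu> * C * \<epsilon> ^ k) \<in> o[at 0](\<lambda>\<epsilon>. \<epsilon> ^ k)"
    if \<nu>: "\<nu> > 0" for \<nu> :: real
  proof -
    define \<kappa> where "\<kappa> \<epsilon> = \<nu> * \<bar>\<epsilon>\<bar> ^ k" for \<epsilon> :: real
    define M where "M \<epsilon> = depth k (\<kappa> \<epsilon>)" for \<epsilon>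
    \<comment> \<open>The bound by \<open>1\<close> gives \<open>r\<^sup>k \<le> r\<close>, so that a quotient linear in \<open>1 / \<nu>\<close> is small enough.\<close>
    define r where "r = min 1 (1 / (32 * \<nu> * (real k + 1)))"
    have r: "0 < r" "r \<le> 1" "\<nu> * r * (real k + 1) \<le> 1 / 32"
    proof -
      show "0 < r" "r \<le> 1" using \<nu> by (auto simp: r_def)
      have "r \<le> 1 / (32 * \<nu> * (real k + 1))" by (simp add: r_def)
      then have "r * (32 * \<nu> * (real k + 1)) \<le> 1" using \<nu> by (simp add: pos_le_divide_eq)
      then show "\<nu> * r * (real k + 1) \<le> 1 / 32" by (simp add: algebra_simps)
    qed
    have \<kappa>0: "0 \<le> \<kappa> \<epsilon>" for \<epsilon> using \<nu> by (simp add: \<kappa>_def)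
    have \<kappa>r: "\<kappa> \<epsilon> * (real k + 1) \<le> 1 / 32" if "\<bar>\<epsilon>\<bar> < r" for \<epsilon>
    proof -
      have "\<bar>\<epsilon>\<bar> ^ k \<le> \<bar>\<epsilon>\<bar> ^ 1" using that r k1 by (intro power_decreasing) auto
      then have "\<kappa> \<epsilon> * (real k + 1) \<le> \<nu> * r * (real k + 1)"
        unfolding \<kappa>_def using that \<nu> by (intro mult_right_mono mult_left_mono) auto
      then show ?thesis using r(3) by (rule order_trans)
    qed
    have M: "0 < M \<epsilon>" "\<bar>1 / (1 + M \<epsilon>) - 1 / 2 - \<nu> * C * \<epsilon> ^ k\<bar>
        \<le> 13 * (pi * (\<kappa> \<epsilon> * (real k + 1)))\<^sup>2" if \<epsilon>: "\<bar>\<epsilon>\<bar> < r" for \<epsilon>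
    proof -
      obtain e v p where "rescaled_flow k (\<kappa> \<epsilon>) e v (variation k (\<kappa> \<epsilon>)) p"
        using variation_flow[OF \<kappa>0] .
      then interpret rescaled_flow k "\<kappa> \<epsilon>" e v "variation k (\<kappa> \<epsilon>)" p .
      note small = \<kappa>r[OF \<epsilon>]
      show pos: "0 < M \<epsilon>" using trough_pos[OF small] by (simp add: M_def depth_def)
      have "\<bar>1 / (1 + M \<epsilon>) - 1 / 2 - \<kappa> \<epsilon> * (real k + 1) * wallis (k + 2) / 4\<bar>
          \<le> 13 * (pi * (\<kappa> \<epsilon> * (real k + 1)))\<^sup>2"
        using trough_expansion[OF small] trough_ge trough_le_1 pos
        by (intro trough_to_threshold) (auto simp: M_def depth_def)
      moreover have "\<kappa> \<epsilon> * (real k + 1) * wallis (k + 2) / 4 = \<nu> * C * \<epsilon> ^ k"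
        using evk by (simp add: \<kappa>_def C_def power_even_abs)
      ultimately show "\<bar>1 / (1 + M \<epsilon>) - 1 / 2 - \<nu> * C * \<epsilon> ^ k\<bar>
          \<le> 13 * (pi * (\<kappa> \<epsilon> * (real k + 1)))\<^sup>2" by simp
    qed
    define \<delta> where "\<delta> \<epsilon> = 1 / (1 + M \<epsilon>) - 1 / 2" for \<epsilon>
    define I where "I = {1/4<..<3/4 :: real}"
    define R where "R = {- r<..<r}"
    have R: "\<bar>\<epsilon>\<bar> < r" if "\<epsilon> \<in> R" for \<epsilon> using that by (auto simp: R_def)
    have smooth: "globally_smooth \<nu> k s0 \<epsilon>"
      if "s0 \<in> I" "\<epsilon> \<in> R" "s0 - 1 / 2 < \<delta> \<epsilon>" for s0 \<epsilon>
    proof -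
      have s0: "0 < s0" "s0 < 1" using that by (auto simp: I_def)
      have "s0 / (1 - s0) * M \<epsilon> < 1"
        using that(3) s0 M(1)[OF R[OF that(2)]] by (simp add: \<delta>_def field_simps)
      then show ?thesis
        using \<nu> s0 by (intro globally_smooth_if_shallow) (auto simp: M_def \<kappa>_def)
    qed
    have blow: "blows_up \<nu> k s0 \<epsilon>"
      if "s0 \<in> I" "\<epsilon> \<in> R" "\<delta> \<epsilon> < s0 - 1 / 2" for s0 \<epsilon>
    proof -
      have s0: "0 < s0" "s0 < 1" using that by (auto simp: I_def)
      have "1 < s0 / (1 - s0) * M \<epsilon>"
        using that(3) s0 M(1)[OF R[OF that(2)]] by (simp add: \<delta>_def field_simps)
      then show ?thesis
        using \<nu> s0 by (intro blows_up_if_deep) (auto simp: M_def \<kappa>_def)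
    qed
    have c\<delta>: "continuous_on R (\<lambda>\<epsilon>. 1 / 2 + \<delta> \<epsilon>)"
    proof -
      have "continuous_on R M"
        unfolding M_def
        by (rule continuous_on_compose2[OF depth_continuous])
          (use \<kappa>0 \<kappa>r R in \<open>auto simp: \<kappa>_def intro!: continuous_intros\<close>)
      then show ?thesis
        unfolding \<delta>_def using M(1) R
        by (intro continuous_intros) (auto simp: add_pos_pos add_nonneg_eq_0_iff less_imp_neq[symmetric])
    qed
    let ?A = "{(s0, E0). s0 < 1 \<and> globally_smooth \<nu> k s0 E0}"
    let ?B = "{(s0, E0). s0 < 1 \<and> blows_up \<nu> k s0 E0}"
    have graph: "closure ?A \<inter> closure ?B \<inter> (I \<times> R) = {(x, y). x = 1 / 2 + \<delta> y} \<inter> (I \<times> R)"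
    proof (rule closures_meet_in_graph)
      show "open I" "open R" by (simp_all add: I_def R_def)
      fix x y assume xy: "x \<in> I" "y \<in> R"
      have x1: "x < 1" using xy by (auto simp: I_def)
      show "(x, y) \<in> ?A \<and> (x, y) \<notin> ?B" if "x < 1 / 2 + \<delta> y"
        using smooth[OF xy] that x1 not_globally_smooth_and_blows_up \<nu> by auto
      show "(x, y) \<in> ?B \<and> (x, y) \<notin> ?A" if "1 / 2 + \<delta> y < x"
        using blow[OF xy] that x1 not_globally_smooth_and_blows_up \<nu> by auto
    qed (rule c\<delta>)
    have sub: "I \<times> R \<subseteq> {(s0, E0). s0 < 1}" by (auto simp: I_def)
    have "threshold_curve \<nu> k \<inter> (I \<times> R) = {(s0, \<epsilon>). s0 - 1 / 2 = \<delta> \<epsilon>} \<inter> (I \<times> R)"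
    proof -
      have "threshold_curve \<nu> k \<inter> (I \<times> R) = closure ?A \<inter> closure ?B \<inter> (I \<times> R)"
        unfolding threshold_curve_def using sub by blast
      then show ?thesis unfolding graph by auto
    qed
    moreover have "open (I \<times> R)" by (auto simp: I_def R_def intro!: open_Times)
    moreover have "(1 / 2, 0) \<in> I \<times> R" using r by (auto simp: I_def R_def)
    moreover have "(\<lambda>\<epsilon>. \<delta> \<epsilon> - \<nu> * C * \<epsilon> ^ k) \<in> o[at 0](\<lambda>\<epsilon>. \<epsilon> ^ k)"
    proof (rule remainder_smallo_power[OF k1 r(1)])
      fix \<epsilon> :: real assume "\<bar>\<epsilon>\<bar> < r"
      then show "\<bar>\<delta> \<epsilon> - \<nu> * C * \<epsilon> ^ k\<bar> \<le> 13 * (pi * \<nu> * (real k + 1))\<^sup>2 * (\<bar>\<epsilon>\<bar> ^ k)\<^sup>2"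
        using M(2)[of \<epsilon>] unfolding \<delta>_def \<kappa>_def by (simp only: power_mult_distrib) (simp add: ac_simps)
    qed
    ultimately show ?thesis
      using smooth blow sub by (intro exI[of _ "I \<times> R"] exI[of _ \<delta>]) auto
  qed
  moreover have "C > 0" using wallis_pos[of "k + 2"] by (simp add: C_def)
  ultimately show ?thesis by blast
qed

end
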